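(* Let $q$ be a prime power; all spaces are over $\mathbb F_q$, and the word "space" is read throughout either as "vector space" or throughout as "affine space" (the statement is asserted in both readings). Let $k,n$ be integers with $0\le k\le n$ and let $r$ be a positive integer. Let $C$ be an $n$-space and let $\mathcal F\subseteq \begin{bmatrix} C\\ k\end{bmatrix}$ be a family of $k$-subspaces of $C$. Then there exist an integer $N$, an $N$-space $X$ and a family $\mathcal H\subseteq \begin{bmatrix} X\\ k\end{bmatrix}$ of $k$-subspaces of $X$ such that for every coloring of $\mathcal H$ with $r$ colors there exists an $n$-subspace $U\in\begin{bmatrix} X\\ n\end{bmatrix}$ for which the family $\begin{bmatrix} U\\ k\end{bmatrix}\cap\mathcal H$ is monochromatic and isomorphic to $\mathcal F$.
   Context: Let $\mathbb F_q$ be the finite field of order $q$. In the vector space reading, a combination is a linear combination over $\mathbb F_q$. In the affine reading, a combination is an affine combination $\sum_i\alpha_i v_i$ with $\sum_i \alpha_i=1$, and an affine space is a subset of a vector space over $\mathbb F_q$ closed under affine combinations (a translate of a linear subspace). A subspace of a space $U$ is a subset closed under combinations; a homomorphism is a map of spaces preserving combinations; an isomorphism is a bijective homomorphism. A subset $B$ of a space is independent if every element of the subspace $\langle B\rangle$ generated by $B$ via combinations has a unique representation as a combination of elements of $B$; it is a basis of $U$ if moreover $\langle B\rangle=U$. The rank of $U$ is the size of a basis of $U$ (so for a vector space it is the dimension, and for an affine space it is the affine dimension plus one). A $k$-space is a space of rank $k$, a $k$-subspace is a subspace of rank $k$, and $\begin{bmatrix} U\\ k\end{bmatrix}$ denotes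 the set of all $k$-subspaces of $U$. Isomorphism of families: given spaces $V$ and $\tilde V$, a family $\mathcal F\subseteq\begin{bmatrix} V\\ k\end{bmatrix}$ is isomorphic to a family $\tilde{\mathcal F}\subseteq\begin{bmatrix}\tilde V\\ k\end{bmatrix}$ if there exist subspaces $U\subseteq V$ and $\tilde U\subseteq\tilde V$ and an isomorphism $\varphi:U\to\tilde U$ such that $\mathcal F\subseteq\begin{bmatrix} U\\ k\end{bmatrix}$, $\tilde{\mathcal F}\subseteq\begin{bmatrix}\tilde U\\ k\end{bmatrix}$, and $\varphi$ induces a bijection between $\mathcal F$ and $\tilde{\mathcal F}$. A family of subspaces is monochromatic if all its members have the same color. *)

theory Defs
  imports Complex_Main "HOL-Library.Function_Algebras"
begin

text \<open>
  A reading fixes what a combination is. A combination of elements of \<open>B\<close> is represented by a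
  finitely supported coefficient function vanishing outside \<open>B\<close>. Repeated vectors in a sum
  \<open>\<Sum>\<^sub>i \<alpha>\<^sub>i v\<^sub>i\<close> are merged; this changes neither the value nor \<open>\<Sum>\<^sub>i \<alpha>\<^sub>i\<close> (see \<open>combination_family\<close>).
\<close>

datatype reading = Vector | Affine

definition coefficients :: "reading \<Rightarrow> 'v set \<Rightarrow> ('v \<Rightarrow> 'a::field) set" where
  "coefficients R B =
     {\<alpha>. finite {b. \<alpha> b \<noteq> 0} \<and> {b. \<alpha> b \<noteq> 0} \<subseteq> B \<and> (R = Affine \<longrightarrow> (\<Sum>b | \<alpha> b \<noteq> 0. \<alpha> b) = 1)}"

definition combination :: "('a::field \<Rightarrow> 'v \<Rightarrow> 'v::ab_group_add) \<Rightarrow> ('v \<Rightarrow> 'a) \<Rightarrow> 'v" where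
  "combination sc \<alpha> = (\<Sum>b | \<alpha> b \<noteq> 0. sc (\<alpha> b) b)"

definition generated :: "reading \<Rightarrow> ('a::field \<Rightarrow> 'v \<Rightarrow> 'v::ab_group_add) \<Rightarrow> 'v set \<Rightarrow> 'v set" where
  "generated R sc B = combination sc ` coefficients R B"

text \<open>
  In the affine reading the empty set is a space: it has no combinations at all, and its rank is 0.
\<close>

definition is_space :: "reading \<Rightarrow> ('a::field \<Rightarrow> 'v \<Rightarrow> 'v::ab_group_add) \<Rightarrow> 'v set \<Rightarrow> bool" where
  "is_space R sc U \<longleftrightarrow> (\<forall>\<alpha>\<in>coefficients R U. combination sc \<alpha> \<in> U)"

definition independent_set :: "reading \<Rightarrow> ('a::field \<Rightarrow> 'v \<Rightarrow> 'v::ab_group_add) \<Rightarrow> 'v set \<Rightarrow> bool" where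
  "independent_set R sc B \<longleftrightarrow>
     (\<forall>x\<in>generated R sc B. \<exists>!\<alpha>. \<alpha> \<in> coefficients R B \<and> combination sc \<alpha> = x)"

definition is_basis :: "reading \<Rightarrow> ('a::field \<Rightarrow> 'v \<Rightarrow> 'v::ab_group_add) \<Rightarrow> 'v set \<Rightarrow> 'v set \<Rightarrow> bool" where
  "is_basis R sc U B \<longleftrightarrow> B \<subseteq> U \<and> independent_set R sc B \<and> generated R sc B = U"

definition k_space :: "reading \<Rightarrow> ('a::field \<Rightarrow> 'v \<Rightarrow> 'v::ab_group_add) \<Rightarrow> nat \<Rightarrow> 'v set \<Rightarrow> bool" where
  "k_space R sc k U \<longleftrightarrow> is_space R sc U \<and> (\<exists>B. is_basis R sc U B \<and> finite B \<and> card B = k)"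

definition k_subspaces ::
  "reading \<Rightarrow> ('a::field \<Rightarrow> 'v \<Rightarrow> 'v::ab_group_add) \<Rightarrow> 'v set \<Rightarrow> nat \<Rightarrow> 'v set set" where
  "k_subspaces R sc U k = {W. W \<subseteq> U \<and> k_space R sc k W}"

definition space_hom :: "reading \<Rightarrow> ('a::field \<Rightarrow> 'v \<Rightarrow> 'v::ab_group_add) \<Rightarrow>
    ('a \<Rightarrow> 'w \<Rightarrow> 'w::ab_group_add) \<Rightarrow> 'v set \<Rightarrow> 'w set \<Rightarrow> ('v \<Rightarrow> 'w) \<Rightarrow> bool" where
  "space_hom R sc sc' U U' \<phi> \<longleftrightarrow> \<phi> ` U \<subseteq> U' \<and>
     (\<forall>\<alpha>\<in>coefficients R U. \<phi> (combination sc \<alpha>) = (\<Sum>b | \<alpha> b \<noteq> 0. sc' (\<alpha> b) (\<phi> b)))"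

definition space_iso :: "reading \<Rightarrow> ('a::field \<Rightarrow> 'v \<Rightarrow> 'v::ab_group_add) \<Rightarrow>
    ('a \<Rightarrow> 'w \<Rightarrow> 'w::ab_group_add) \<Rightarrow> 'v set \<Rightarrow> 'w set \<Rightarrow> ('v \<Rightarrow> 'w) \<Rightarrow> bool" where
  "space_iso R sc sc' U U' \<phi> \<longleftrightarrow> space_hom R sc sc' U U' \<phi> \<and> bij_betw \<phi> U U'"

definition isomorphic_families :: "reading \<Rightarrow> ('a::field \<Rightarrow> 'v \<Rightarrow> 'v::ab_group_add) \<Rightarrow>
    ('a \<Rightarrow> 'w \<Rightarrow> 'w::ab_group_add) \<Rightarrow> 'v set \<Rightarrow> 'w set \<Rightarrow> nat \<Rightarrow> 'v set set \<Rightarrow> 'w set set \<Rightarrow> bool" where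
  "isomorphic_families R sc sc' V V' k \<F> \<F>' \<longleftrightarrow>
     (\<exists>U U' \<phi>. U \<subseteq> V \<and> is_space R sc U \<and> U' \<subseteq> V' \<and> is_space R sc' U' \<and>
        space_iso R sc sc' U U' \<phi> \<and>
        \<F> \<subseteq> k_subspaces R sc U k \<and> \<F>' \<subseteq> k_subspaces R sc' U' k \<and>
        bij_betw ((`) \<phi>) \<F> \<F>')"

definition monochromatic :: "('s \<Rightarrow> nat) \<Rightarrow> 's set \<Rightarrow> bool" where
  "monochromatic \<chi> \<G> \<longleftrightarrow> (\<exists>a. \<forall>S\<in>\<G>. \<chi> S = a)"

text \<open>
  The sequence space over the field has finite-dimensional subspaces of every dimension, so it
  hosts an isomorphic copy of every finite-rank space.
\<close>

definition fun_scale :: "'a::field \<Rightarrow> (nat \<Rightarrow> 'a) \<Rightarrow> nat \<Rightarrow> 'a" where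
  "fun_scale c f = (\<lambda>i. c * f i)"

lemma vector_space_fun_scale: "vector_space fun_scale"
  by unfold_locales (auto simp: fun_scale_def fun_eq_iff algebra_simps)


subsection \<open>Agreement with the library notions\<close>

context vector_space
begin

lemma combination_family:
  assumes "finite I" and "\<And>i. i \<in> I \<Longrightarrow> v i \<in> B" and "R = Affine \<Longrightarrow> sum a I = 1"
  shows "(\<Sum>i\<in>I. scale (a i) (v i)) \<in> generated R scale B"
proof -
  define \<alpha> where "\<alpha> b = (\<Sum>i\<in>{i\<in>I. v i = b}. a i)" for b
  have sub: "{b. \<alpha> b \<noteq> 0} \<subseteq> v ` I"
  proof
    fix b assume "b \<in> {b. \<alpha> b \<noteq> 0}"
    then have "{i\<in>I. v i = b} \<noteq> {}"
      unfolding \<alpha>_def by (metis (mono_tags) mem_Collect_eq sum.empty)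
    then show "b \<in> v ` I" by blast
  qed
  then have fin: "finite {b. \<alpha> b \<noteq> 0}"
    using assms(1) finite_subset by blast
  have "(\<Sum>b | \<alpha> b \<noteq> 0. \<alpha> b) = (\<Sum>b\<in>v ` I. \<alpha> b)"
    by (rule sum.mono_neutral_left) (use sub assms(1) in auto)
  also have "\<dots> = sum a I"
    unfolding \<alpha>_def by (rule sum.image_gen[OF assms(1), symmetric])
  finally have s: "(\<Sum>b | \<alpha> b \<noteq> 0. \<alpha> b) = sum a I" .
  have "combination scale \<alpha> = (\<Sum>b\<in>v ` I. scale (\<alpha> b) b)"
    unfolding combination_def by (rule sum.mono_neutral_left) (use sub assms(1) in auto)
  also have "\<dots> = (\<Sum>b\<in>v ` I. \<Sum>i\<in>{i\<in>I. v i = b}. scale (a i) (v i))"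
    unfolding \<alpha>_def by (auto simp: scale_sum_left intro!: sum.cong)
  also have "\<dots> = (\<Sum>i\<in>I. scale (a i) (v i))"
    by (rule sum.image_gen[OF assms(1), symmetric])
  finally have c: "combination scale \<alpha> = (\<Sum>i\<in>I. scale (a i) (v i))" .
  have "\<alpha> \<in> coefficients R B"
    unfolding coefficients_def using fin sub s assms(2,3) by auto
  then show ?thesis
    unfolding generated_def using c by (metis imageI)
qed

lemma is_space_generated: "is_space R scale U \<longleftrightarrow> generated R scale U \<subseteq> U"
  by (auto simp: is_space_def generated_def)

lemma generated_Vector: "generated Vector scale B = span B"
  unfolding span_alt generated_def coefficients_def combination_def by auto

lemma is_space_Vector: "is_space Vector scale U \<longleftrightarrow> subspace U"
  unfolding is_space_generated generated_Vector
  by (metis span_eq_iff span_superset subset_antisym)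

lemma independent_set_Vector: "independent_set Vector scale B \<longleftrightarrow> independent B"
proof
  assume i: "independent_set Vector scale B"
  show "independent B"
  proof (subst independent_alt, intro allI impI)
    fix X assume X: "finite {x. X x \<noteq> 0}" "{x. X x \<noteq> 0} \<subseteq> B" "(\<Sum>x | X x \<noteq> 0. scale (X x) x) = 0"
    have 1: "X \<in> coefficients Vector B \<and> combination scale X = 0"
      using X by (simp add: coefficients_def combination_def)
    have 2: "(\<lambda>_. 0) \<in> coefficients Vector B \<and> combination scale (\<lambda>_. 0) = 0"
      by (simp add: coefficients_def combination_def)
    have "0 \<in> generated Vector scale B" by (simp add: generated_Vector span_zero)
    with i 1 2 have "X = (\<lambda>_. 0)" unfolding independent_set_def by metis
    then show "X x = 0" for x by simp
  qed
next
  assume i: "independent B"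
  show "independent_set Vector scale B"
    unfolding independent_set_def
  proof (intro ballI ex_ex1I)
    fix x assume "x \<in> generated Vector scale B"
    then show "\<exists>\<alpha>. \<alpha> \<in> coefficients Vector B \<and> combination scale \<alpha> = x"
      by (auto simp: generated_def)
  next
    fix x \<alpha> \<beta>
    assume a: "\<alpha> \<in> coefficients Vector B \<and> combination scale \<alpha> = x"
      and b: "\<beta> \<in> coefficients Vector B \<and> combination scale \<beta> = x"
    show "\<alpha> = \<beta>"
      using unique_representation[OF i, of \<alpha> \<beta>] a b
      by (auto simp: coefficients_def combination_def)
  qed
qed

lemma k_space_Vector:
  "k_space Vector scale k U \<longleftrightarrow>
     subspace U \<and> (\<exists>B. independent B \<and> span B = U \<and> finite B \<and> card B = k)"
  unfolding k_space_def is_basis_def is_space_Vector independent_set_Vector generated_Vector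
  using span_superset by blast

lemma k_space_Vector_dim: "k_space Vector scale k U \<Longrightarrow> dim U = k"
  unfolding k_space_Vector using dim_span_eq_card_independent by blast

lemma is_space_Affine:
  assumes "U \<noteq> {}"
  shows "is_space Affine scale U \<longleftrightarrow> (\<exists>p L. subspace L \<and> U = (\<lambda>x. p + x) ` L)"
proof
  assume U: "is_space Affine scale U"
  obtain p where p: "p \<in> U" using assms by blast
  have comb: "scale a x + scale b y + scale c z \<in> U"
    if "x \<in> U" "y \<in> U" "z \<in> U" "a + b + c = 1" for a b c x y z
  proof -
    have "(\<Sum>i\<in>{0,1,2::nat}. scale (if i = 0 then a else if i = 1 then b else c)
        (if i = 0 then x else if i = 1 then y else z)) \<in> generated Affine scale U"
      by (rule combination_family) (use that in \<open>auto simp: add.assoc\<close>)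
    then show ?thesis using U by (auto simp: is_space_generated add.assoc)
  qed
  have "subspace {x. p + x \<in> U}"
  proof (rule subspaceI; clarsimp?)
    show "p \<in> U" by (rule p)
  next
    fix x y assume xy: "p + x \<in> U" "p + y \<in> U"
    show "p + (x + y) \<in> U"
      using comb[OF xy p, of 1 1 "-1"] by (simp add: algebra_simps)
  next
    fix c x assume x: "p + x \<in> U"
    show "p + scale c x \<in> U"
      using comb[OF x p p, of c "1 - c" 0] by (simp add: algebra_simps)
  qed
  moreover have "U = (\<lambda>x. p + x) ` {x. p + x \<in> U}"
    (is "_ = _ ` ?L")
  proof
    show "U \<subseteq> (\<lambda>x. p + x) ` ?L"
    proof
      fix x assume "x \<in> U"
      then show "x \<in> (\<lambda>x. p + x) ` ?L" by (intro image_eqI[where x = "x - p"]) auto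
    qed
  qed auto
  ultimately show "\<exists>p L. subspace L \<and> U = (\<lambda>x. p + x) ` L" by blast
next
  assume "\<exists>p L. subspace L \<and> U = (\<lambda>x. p + x) ` L"
  then obtain p L where L: "subspace L" and U: "U = (\<lambda>x. p + x) ` L" by blast
  show "is_space Affine scale U"
    unfolding is_space_def
  proof
    fix \<alpha> :: "'b \<Rightarrow> 'a" assume a: "\<alpha> \<in> coefficients Affine U"
    let ?S = "{b. \<alpha> b \<noteq> 0}"
    have "combination scale \<alpha> = (\<Sum>b\<in>?S. scale (\<alpha> b) p + scale (\<alpha> b) (b - p))"
      unfolding combination_def by (simp flip: scale_right_distrib)
    also have "\<dots> = p + (\<Sum>b\<in>?S. scale (\<alpha> b) (b - p))"
      using a by (simp add: sum.distrib coefficients_def flip: scale_sum_left)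
    finally have "combination scale \<alpha> = p + (\<Sum>b\<in>?S. scale (\<alpha> b) (b - p))" .
    moreover have "(\<Sum>b\<in>?S. scale (\<alpha> b) (b - p)) \<in> L"
      by (rule subspace_sum[OF L], rule subspace_scale[OF L])
         (use a in \<open>auto simp: coefficients_def U\<close>)
    ultimately show "combination scale \<alpha> \<in> U" unfolding U by blast
  qed
qed

end

end

theory Submission
  imports Defs "HOL-Library.FuncSet" "HOL-Library.Cardinality"
begin

text \<open>
  Homogenisation reduces both readings to linear subspaces of the sequence space, where in the
  affine reading only subspaces not contained in the kernel of a fixed functional count.
  A section of a linear map \<open>\<pi>\<close> over a subspace is a letter, and a word of sections is a section of
  a fibre power of \<open>\<pi>\<close>; a combinatorial line of such words is a linear embedding into the fibre
  power. Hence the Hales--Jewett theorem makes the colour of a subspace transversal to the kernel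
  of \<open>\<pi>\<close> depend on its projection only. Induction on the rank then gives the Ramsey theorem of
  Graham, Leeb and Rothschild. Its induced version follows by the partite construction of
  Nesetril and Roedl: start from disjoint copies of \<open>\<F>\<close> lying above the \<open>n\<close>-subspaces of a Ramsey
  space, and for each \<open>k\<close>-subspace \<open>Y\<close> of that space in turn amalgamate copies of the current system
  along the lines of a fibre power over \<open>Y\<close>. In the end colours depend on projections only.
\<close>

subsection \<open>The Hales--Jewett theorem\<close>

text \<open>The obstacle is inducedness: a copy of the family may contain accidental members that
  belong to another copy of the amalgam. Tag coordinates make two copies in the initial system meet
  in 0 only, and force a member shared by two lines to project onto \<open>Y\<close>, where it is
  recognised as an old member. Fibre powers need no new type, because interleaving identifies the
  sequence space with its finite powers. In the affine reading every embedding keeps coordinate 0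
  (later: coordinate 0 of the projection), so one linear proof with a flag \<open>A\<close> covers
  both readings. Since the field is finite, ranks are counted, and an inclusion of subspaces of
  equal rank becomes an equality by cardinality. Rank 0 stands apart: copies of the zero subspace
  cannot be kept disjoint, but a space has just one 0-subspace, so there is nothing to colour. The
  linear theorem lives in an infinite ambient space; finite rank is recovered at the end, because a
  finite family has finitely many colourings and one copy per colouring is enough.\<close>

definition fill :: "'b \<Rightarrow> 'b option list \<Rightarrow> 'b list" where
  "fill a w = map (case_option a id) w"

definition lines :: "'b set \<Rightarrow> nat \<Rightarrow> 'b option list set" where
  "lines A m = {w. length w = m \<and> None \<in> set w \<and> set w \<subseteq> insert None (Some ` A)}"

definition hales_jewett :: "'b set \<Rightarrow> bool" where
  "hales_jewett A \<longleftrightarrow> (\<forall>r>0. \<exists>m. \<forall>\<chi>::'b list \<Rightarrow> nat.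
     (\<forall>x. \<chi> x < r) \<longrightarrow> (\<exists>w\<in>lines A m. \<exists>c. \<forall>a\<in>A. \<chi> (fill a w) = c))"

lemma fill_append: "fill a (v @ w) = fill a v @ fill a w"
  by (simp add: fill_def)

lemma fill_map_Some [simp]: "fill a (map Some x) = x"
  by (simp add: fill_def comp_def)

lemma length_fill [simp]: "length (fill a w) = length w"
  by (simp add: fill_def)

lemma set_fill: "set w \<subseteq> insert None (Some ` A) \<Longrightarrow> a \<in> A \<Longrightarrow> set (fill a w) \<subseteq> A"
  unfolding fill_def by (auto split: option.split)

lemma finite_lines: "finite A \<Longrightarrow> finite (lines A m)"
  unfolding lines_def
  by (rule finite_subset[OF _ finite_lists_length_eq[of "insert None (Some ` A)" m]]) auto

text \<open>Hales--Jewett is applied to the product colouring, which sends a word to its whole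
  function from \<open>V\<close> to \<open>{..<r}\<close>; there are finitely many such functions,
  and \<open>g\<close> numbers them. The index set will be the tails of a word in the focusing
  argument, and later the subsets of a base space.\<close>

lemma hales_jewett_simultaneous:
  assumes hj: "hales_jewett A" and "finite V" and "0 < r"
  shows "\<exists>m. \<forall>\<chi>::'c \<Rightarrow> 'b list \<Rightarrow> nat. (\<forall>v x. \<chi> v x < r) \<longrightarrow>
           (\<exists>w\<in>lines A m. \<forall>v\<in>V. \<exists>c. \<forall>a\<in>A. \<chi> v (fill a w) = c)"
proof -
  let ?P = "PiE V (\<lambda>_. {..<r})"
  have "finite ?P" using assms by (intro finite_PiE) auto
  then obtain g :: "('c \<Rightarrow> nat) \<Rightarrow> nat" and n where g: "g ` ?P = {i. i < n}" "inj_on g ?P"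
    using finite_imp_inj_to_nat_seg by blast
  have "(\<lambda>v\<in>V. 0) \<in> ?P" using \<open>0 < r\<close> by auto
  then have "g (\<lambda>v\<in>V. 0) < n" using g(1) by blast
  then have "0 < n" by simp
  then obtain m where m: "\<And>\<chi>::'b list \<Rightarrow> nat. (\<forall>x. \<chi> x < n) \<Longrightarrow>
      (\<exists>w\<in>lines A m. \<exists>c. \<forall>a\<in>A. \<chi> (fill a w) = c)"
    using hj unfolding hales_jewett_def by blast
  show ?thesis
  proof (intro exI allI impI)
    fix \<chi> :: "'c \<Rightarrow> 'b list \<Rightarrow> nat" assume b: "\<forall>v x. \<chi> v x < r"
    have P: "(\<lambda>v\<in>V. \<chi> v x) \<in> ?P" for x using b by auto
    have "\<forall>x. g (\<lambda>v\<in>V. \<chi> v x) < n" using P g(1) by blast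
    from m[OF this] obtain w c where w: "w \<in> lines A m" "\<And>a. a \<in> A \<Longrightarrow> g (\<lambda>v\<in>V. \<chi> v (fill a w)) = c"
      by blast
    have "\<chi> v (fill a w) = \<chi> v (fill b w)" if "v \<in> V" "a \<in> A" "b \<in> A" for v a b
    proof -
      have "(\<lambda>v\<in>V. \<chi> v (fill a w)) = (\<lambda>v\<in>V. \<chi> v (fill b w))"
        by (rule inj_onD[OF g(2) _ P P]) (simp add: w(2) that)
      from fun_cong[OF this, of v] show ?thesis using that by simp
    qed
    then show "\<exists>w\<in>lines A m. \<forall>v\<in>V. \<exists>c. \<forall>a\<in>A. \<chi> v (fill a w) = c"
      using w(1) by (intro bexI[of _ w]) blast+
  qed
qed

section \<open>Colour focusing, the induction step of Hales--Jewett\<close>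

definition mono_line :: "'b set \<Rightarrow> nat \<Rightarrow> ('b list \<Rightarrow> nat) \<Rightarrow> bool" where
  "mono_line A m \<chi> \<longleftrightarrow> (\<exists>w\<in>lines A m. \<exists>c. \<forall>a\<in>A. \<chi> (fill a w) = c)"

definition focused_lines :: "'b set \<Rightarrow> 'b \<Rightarrow> nat \<Rightarrow> ('b list \<Rightarrow> nat) \<Rightarrow> 'b list \<Rightarrow> nat set \<Rightarrow> bool" where
  "focused_lines A a m \<chi> f C \<longleftrightarrow> length f = m \<and> set f \<subseteq> insert a A \<and>
     (\<forall>c\<in>C. \<exists>w\<in>lines (insert a A) m. fill a w = f \<and> (\<forall>b\<in>A. \<chi> (fill b w) = c))"

text \<open>Used at \<open>s = r\<close>, where the focus must repeat one of the colours. To gain a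
  colour, a block of length \<open>M\<close> is put in front, in which Hales--Jewett for
  \<open>A\<close> makes the colour independent of the old letter for all tails at once. What
  remains is a colouring \<open>d\<close> of the tails, to which the induction hypothesis
  applies.\<close>

lemma colour_focusing:
  assumes hj: "hales_jewett A" and fin: "finite A" and b0: "b0 \<in> A" and r: "0 < r"
  shows "\<exists>m. \<forall>\<chi>::'b list \<Rightarrow> nat. (\<forall>x. \<chi> x < r) \<longrightarrow> mono_line (insert a A) m \<chi> \<or>
    (\<exists>f C. C \<subseteq> {..<r} \<and> card C = s \<and> focused_lines A a m \<chi> f C)"
proof (induction s)
  case 0
  have "focused_lines A a 0 \<chi> [] {}" for \<chi>
    by (simp add: focused_lines_def)
  then show ?case
    by (intro exI[of _ 0] allI impI disjI2 exI[of _ "[]"] exI[of _ "{}"]) simp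
next
  case (Suc s)
  then obtain m where m: "\<And>\<chi>::'b list \<Rightarrow> nat. \<forall>x. \<chi> x < r \<Longrightarrow> mono_line (insert a A) m \<chi> \<or>
    (\<exists>f C. C \<subseteq> {..<r} \<and> card C = s \<and> focused_lines A a m \<chi> f C)" by blast
  let ?V = "{v. set v \<subseteq> insert a A \<and> length v = m}"
  have "finite ?V" using fin by (intro finite_lists_length_eq) auto
  from hales_jewett_simultaneous[OF hj this r] obtain M where
    M: "\<And>\<chi>::'b list \<Rightarrow> 'b list \<Rightarrow> nat. \<forall>v x. \<chi> v x < r \<Longrightarrow>
           \<exists>w\<in>lines A M. \<forall>v\<in>?V. \<exists>c. \<forall>a\<in>A. \<chi> v (fill a w) = c"
    by blast
  have "mono_line (insert a A) (M + m) \<chi> \<or>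
      (\<exists>f C. C \<subseteq> {..<r} \<and> card C = Suc s \<and> focused_lines A a (M + m) \<chi> f C)"
    if bd: "\<forall>x. \<chi> x < r" for \<chi> :: "'b list \<Rightarrow> nat"
  proof -
    have "\<forall>v x. \<chi> (x @ v) < r" using bd by simp
    from M[OF this] obtain w0 where w0: "w0 \<in> lines A M"
      and mono0: "\<forall>v\<in>?V. \<exists>c. \<forall>a\<in>A. \<chi> (fill a w0 @ v) = c"
      by blast
    define d where "d v = \<chi> (fill b0 w0 @ v)" for v
    have d: "\<chi> (fill b w0 @ v) = d v" if "v \<in> ?V" "b \<in> A" for v b
    proof -
      obtain c where "\<forall>a\<in>A. \<chi> (fill a w0 @ v) = c" using mono0 \<open>v \<in> ?V\<close> by blast
      then show ?thesis using that b0 by (simp add: d_def)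
    qed
    have w0': "length w0 = M" "None \<in> set w0" "set w0 \<subseteq> insert None (Some ` A)"
      using w0 by (auto simp: lines_def)
    have s0: "set (fill b0 w0) \<subseteq> A" using set_fill w0'(3) b0 by metis
    \<comment> \<open>A line for \<open>d\<close> becomes a line for \<open>\<chi>\<close> behind a
      constant block; that block is filled with \<open>b0\<close> because \<open>d\<close> was read
      off there.\<close>
    have lift: "mono_line (insert a A) (M + m) \<chi>" if w: "w \<in> lines (insert a A) m"
      and c: "\<forall>b\<in>insert a A. d (fill b w) = c" for w c
      unfolding mono_line_def
    proof
      show "map Some (fill b0 w0) @ w \<in> lines (insert a A) (M + m)"
        using w w0' s0 by (auto simp: lines_def)
      show "\<exists>c. \<forall>b\<in>insert a A. \<chi> (fill b (map Some (fill b0 w0) @ w)) = c"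
        using c by (auto simp: fill_append d_def)
    qed
    have "\<forall>x. d x < r" using bd by (simp add: d_def)
    from m[OF this] show ?thesis
    proof
      assume "mono_line (insert a A) m d" then show ?thesis
        using lift unfolding mono_line_def by blast
    next
      assume "\<exists>f C. C \<subseteq> {..<r} \<and> card C = s \<and> focused_lines A a m d f C"
      then obtain f C where C: "C \<subseteq> {..<r}" "card C = s" and f: "length f = m" "set f \<subseteq> insert a A"
        and w: "\<And>c. c \<in> C \<Longrightarrow> \<exists>w\<in>lines (insert a A) m. fill a w = f \<and> (\<forall>b\<in>A. d (fill b w) = c)"
        unfolding focused_lines_def by blast
      show ?thesis
      proof (cases "d f \<in> C")
        \<comment> \<open>The focus has the colour of one of its lines, so that line is
          monochromatic with the letter \<open>a\<close> included.\<close>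
        case True
        from w[OF this] obtain w where "w \<in> lines (insert a A) m" "fill a w = f"
          "\<forall>b\<in>A. d (fill b w) = d f" by blast
        then show ?thesis using lift[of w "d f"] by simp
      next
        case False
        have fV: "f \<in> ?V" using f by simp
        \<comment> \<open>The new focus has \<open>a\<close> filled into both blocks. The line
          moving in the first block only brings the new colour \<open>d f\<close>; an old line now
          moves in both blocks and keeps its colour.\<close>
        have "\<exists>w\<in>lines (insert a A) (M + m). fill a w = fill a w0 @ f \<and> (\<forall>b\<in>A. \<chi> (fill b w) = c)"
          if c: "c \<in> insert (d f) C" for c
        proof (cases "c = d f")
          case True
          have "w0 @ map Some f \<in> lines (insert a A) (M + m)"
            using w0' f by (auto simp: lines_def)
          then show ?thesis
            by (rule bexI[rotated]) (use True d[OF fV] in \<open>simp add: fill_append\<close>)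
        next
          case False
          then obtain w1 where w1: "w1 \<in> lines (insert a A) m" "fill a w1 = f" "\<forall>b\<in>A. d (fill b w1) = c"
            using w[of c] c by blast
          have l: "w0 @ w1 \<in> lines (insert a A) (M + m)"
            using w0' w1(1) by (auto simp: lines_def)
          have v: "fill b w1 \<in> ?V" if "b \<in> A" for b
            using w1(1) set_fill[of w1 "insert a A" b] that by (simp add: lines_def)
          have "\<forall>b\<in>A. \<chi> (fill b (w0 @ w1)) = c"
            using w1(3) d[OF v] by (simp add: fill_append)
          then show ?thesis using l w1(2) fill_append by metis
        qed
        then have "focused_lines A a (M + m) \<chi> (fill a w0 @ f) (insert (d f) C)"
          unfolding focused_lines_def
          using w0' f set_fill[of w0 "insert a A" a] by auto
        moreover have "card (insert (d f) C) = Suc s"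
          using False C finite_subset[OF C(1)] by simp
        moreover have "insert (d f) C \<subseteq> {..<r}" using C bd by (simp add: d_def)
        ultimately show ?thesis by blast
      qed
    qed
  qed
  then show ?case by blast
qed

theorem hales_jewett:
  assumes "finite A" "A \<noteq> {}"
  shows "hales_jewett A"
  using assms
proof (induction A rule: finite_ne_induct)
  case (singleton a)
  have "[None] \<in> lines {a} 1" by (simp add: lines_def)
  then show ?case unfolding hales_jewett_def by blast
next
  case (insert a A)
  obtain b0 where b0: "b0 \<in> A" using insert(2) by blast
  have "\<exists>m. \<forall>\<chi>. (\<forall>x. \<chi> x < r) \<longrightarrow> mono_line (insert a A) m \<chi>" if r: "0 < r" for r
  proof -
    obtain m where m: "\<And>\<chi>. \<forall>x. \<chi> x < r \<Longrightarrow> mono_line (insert a A) m \<chi> \<or>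
        (\<exists>f C. C \<subseteq> {..<r} \<and> card C = r \<and> focused_lines A a m \<chi> f C)"
      using colour_focusing[OF insert(4,1) b0 r, of a r] by blast
    have "mono_line (insert a A) m \<chi>" if bd: "\<forall>x. \<chi> x < r" for \<chi>
      using m[OF bd]
    proof
      assume "\<exists>f C. C \<subseteq> {..<r} \<and> card C = r \<and> focused_lines A a m \<chi> f C"
      then obtain f C where C: "C \<subseteq> {..<r}" "card C = r" and f: "focused_lines A a m \<chi> f C"
        by blast
      \<comment> \<open>The \<open>r\<close> focused colours exhaust all colours, so the focus
        shares its colour with one of its lines.\<close>
      have "C = {..<r}" using C by (intro card_subset_eq) auto
      then have "\<chi> f \<in> C" using bd by simp
      then obtain w where "w \<in> lines (insert a A) m" "fill a w = f" "\<forall>b\<in>A. \<chi> (fill b w) = \<chi> f"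
        using f unfolding focused_lines_def by blast
      then have "w \<in> lines (insert a A) m" "\<forall>b\<in>insert a A. \<chi> (fill b w) = \<chi> f"
        by auto
      then show ?thesis unfolding mono_line_def by blast
    qed
    then show ?thesis by blast
  qed
  then show ?case unfolding hales_jewett_def mono_line_def by blast
qed

subsection \<open>Linear maps on the sequence space\<close>

abbreviation lin :: "((nat \<Rightarrow> 'a::field) \<Rightarrow> nat \<Rightarrow> 'a) \<Rightarrow> bool" where
  "lin \<equiv> Vector_Spaces.linear fun_scale fun_scale"

abbreviation subsp :: "(nat \<Rightarrow> 'a::field) set \<Rightarrow> bool" where
  "subsp \<equiv> module.subspace fun_scale"

interpretation fs: vector_space_pair fun_scale fun_scale
  by (intro vector_space_pair.intro vector_space_fun_scale)

lemma fun_scale_apply [simp]: "fun_scale c x i = c * x i"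
  by (simp add: fun_scale_def)

lemma lin_iff: "lin f \<longleftrightarrow> (\<forall>x y. f (x + y) = f x + f y) \<and> (\<forall>c x. f (fun_scale c x) = fun_scale c (f x))"
  by (simp add: Vector_Spaces.linear_iff vector_space_fun_scale)

lemma linI: "(\<And>x y. f (x + y) = f x + f y) \<Longrightarrow> (\<And>c x. f (fun_scale c x) = fun_scale c (f x)) \<Longrightarrow> lin f"
  by (simp add: lin_iff)

lemma lin_add: "lin f \<Longrightarrow> f (x + y) = f x + f y"
  and lin_scale: "lin f \<Longrightarrow> f (fun_scale c x) = fun_scale c (f x)"
  by (simp_all add: lin_iff)

lemma lin_0: "lin f \<Longrightarrow> f 0 = 0"
  by (rule fs.linear_0)

lemma lin_diff: "lin f \<Longrightarrow> f (x - y) = f x - f y"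
  by (rule fs.linear_diff)

lemma lin_id: "lin id" "lin (\<lambda>x. x)"
  and lin_sub: "lin f \<Longrightarrow> lin g \<Longrightarrow> lin (\<lambda>x. f x - g x)"
  and lin_plus: "lin f \<Longrightarrow> lin g \<Longrightarrow> lin (\<lambda>x. f x + g x)"
  and lin_zero: "lin (\<lambda>x. 0)"
  by (auto simp: lin_iff fun_eq_iff algebra_simps)

lemma lin_compose: "lin f \<Longrightarrow> lin g \<Longrightarrow> lin (\<lambda>x. f (g x))"
  by (simp add: lin_iff)

lemma subsp_image: "lin f \<Longrightarrow> subsp W \<Longrightarrow> subsp (f ` W)"
  by (rule fs.linear_subspace_image)

text \<open>The left inverse \<open>g1\<close> on \<open>W\<close> need not be a section elsewhere;
  its error \<open>v - \<pi> (g1 v)\<close> is corrected by an arbitrary right inverse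
  \<open>g0\<close> and vanishes on the image of \<open>W\<close>. The section must work on the
  whole range of \<open>\<pi>\<close>, since line embeddings also carry points that do not project
  into the image of \<open>W\<close>.\<close>

lemma linear_section:
  assumes "lin \<pi>" "subsp W" "inj_on \<pi> W"
  obtains s where "lin s" "\<And>x. \<pi> (s (\<pi> x)) = \<pi> x" "\<And>w. w \<in> W \<Longrightarrow> s (\<pi> w) = w"
proof -
  obtain g1 where g1: "lin g1" "g1 ` UNIV \<subseteq> W" "\<forall>w\<in>W. g1 (\<pi> w) = w"
    using fs.linear_exists_left_inverse_on[OF assms] by blast
  obtain g0 where g0: "lin g0" "\<forall>v\<in>range \<pi>. \<pi> (g0 v) = v"
    using fs.linear_exists_right_inverse_on[OF assms(1) fs.vs1.subspace_UNIV] by blast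
  show thesis
  proof
    show "lin (\<lambda>v. g1 v + g0 (v - \<pi> (g1 v)))"
      by (intro lin_plus lin_compose[OF g0(1)] lin_sub lin_compose[OF assms(1)] g1(1) lin_id)
    have "\<pi> x - \<pi> (g1 (\<pi> x)) = \<pi> (x - g1 (\<pi> x))" for x
      by (simp add: lin_diff[OF assms(1)])
    then have "\<pi> (g0 (\<pi> x - \<pi> (g1 (\<pi> x)))) = \<pi> x - \<pi> (g1 (\<pi> x))" for x
      using g0(2) by (metis rangeI)
    then show "\<pi> (g1 (\<pi> x) + g0 (\<pi> x - \<pi> (g1 (\<pi> x)))) = \<pi> x" for x
      by (simp add: lin_add[OF assms(1)])
    show "w \<in> W \<Longrightarrow> g1 (\<pi> w) + g0 (\<pi> w - \<pi> (g1 (\<pi> w))) = w" for w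
      using g1(3) by (simp add: lin_0[OF g0(1)])
  qed
qed

text \<open>Subtract from the identity a linear projection onto \<open>Y\<close>. This supplies the
  tag that vanishes exactly on \<open>Y\<close>.\<close>

lemma linear_with_kernel:
  assumes "subsp Y"
  obtains \<theta> :: "(nat \<Rightarrow> 'a::field) \<Rightarrow> nat \<Rightarrow> 'a" where "lin \<theta>" "\<And>v. \<theta> v = 0 \<longleftrightarrow> v \<in> Y"
proof -
  obtain p where p: "lin p" "p ` UNIV \<subseteq> Y" "\<forall>w\<in>Y. p (id w) = w"
    using fs.linear_exists_left_inverse_on[OF lin_id(1) assms inj_on_id] by blast
  show thesis
  proof
    show "lin (\<lambda>v. v - p v)" by (intro lin_sub lin_id p)
    show "v - p v = 0 \<longleftrightarrow> v \<in> Y" for v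
      using p(2,3) by (metis eq_iff_diff_eq_0 id_apply range_subsetD)
  qed
qed

section \<open>Interleaving: the sequence space as a finite power of itself\<close>

definition inter :: "nat \<Rightarrow> (nat \<Rightarrow> nat \<Rightarrow> 'a) \<Rightarrow> nat \<Rightarrow> 'a" where
  "inter m x = (\<lambda>n. x (n mod m) (n div m))"

definition part :: "nat \<Rightarrow> nat \<Rightarrow> (nat \<Rightarrow> 'a) \<Rightarrow> nat \<Rightarrow> 'a" where
  "part m j f = (\<lambda>i. f (i * m + j))"

lemma part_inter [simp]: "j < m \<Longrightarrow> part m j (inter m x) = x j"
  by (simp add: part_def inter_def fun_eq_iff)

text \<open>Coordinate 0 of the power is coordinate 0 of component 0, so the functional that cuts
  out the affine level set survives interleaving.\<close>

lemma inter_0 [simp]: "inter m x 0 = x 0 0"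
  by (simp add: inter_def)

lemma inter_cong: "0 < m \<Longrightarrow> (\<And>j. j < m \<Longrightarrow> x j = y j) \<Longrightarrow> inter m x = inter m y"
  by (simp add: inter_def fun_eq_iff)

lemma lin_part: "lin (part m j)"
  by (auto simp: lin_iff part_def fun_eq_iff)

lemma lin_inter:
  assumes "0 < m" "\<And>j. j < m \<Longrightarrow> lin (f j)"
  shows "lin (\<lambda>b. inter m (\<lambda>j. f j b))"
  by (rule linI) (simp_all add: inter_def fun_eq_iff lin_add[OF assms(2)] lin_scale[OF assms(2)] assms(1))

section \<open>Standard finite-dimensional subspaces\<close>

definition vec :: "nat \<Rightarrow> (nat \<Rightarrow> 'a::zero) set" where
  "vec n = {f. \<forall>i\<ge>n. f i = 0}"

definition trunc :: "nat \<Rightarrow> (nat \<Rightarrow> 'a::zero) \<Rightarrow> nat \<Rightarrow> 'a" where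
  "trunc n f = (\<lambda>i. if i < n then f i else 0)"

lemma lin_trunc: "lin (trunc n)"
  by (auto simp: lin_iff trunc_def fun_eq_iff)

lemma subsp_vec: "subsp (vec n)"
  by (auto simp: fs.vs1.subspace_def vec_def)

lemma trunc_in_vec [simp]: "trunc n x \<in> vec n"
  by (simp add: trunc_def vec_def)

lemma trunc_vec [simp]: "x \<in> vec n \<Longrightarrow> trunc n x = x"
  by (auto simp: trunc_def vec_def fun_eq_iff)

lemma vec_mono: "m \<le> n \<Longrightarrow> vec m \<subseteq> vec n"
  by (auto simp: vec_def)

lemma inter_in_vec: "(\<And>j. j < m \<Longrightarrow> x j \<in> vec D) \<Longrightarrow> 0 < m \<Longrightarrow> inter m x \<in> vec (m * D)"
  by (auto simp: vec_def inter_def less_eq_div_iff_mult_less_eq mult.commute)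

lemma bij_betw_restrict_support:
  "bij_betw (\<lambda>f. restrict f B) {f::'b \<Rightarrow> 'a::{zero}. {x. f x \<noteq> 0} \<subseteq> B} (PiE B (\<lambda>_. UNIV))"
proof (rule bij_betwI[where g = "\<lambda>f x. if x \<in> B then f x else 0"])
qed (auto simp: fun_eq_iff PiE_def extensional_def split: if_splits)

lemma finite_supported: "finite B \<Longrightarrow> finite {f::'b \<Rightarrow> 'a::{zero,finite}. {x. f x \<noteq> 0} \<subseteq> B}"
  using bij_betw_finite[OF bij_betw_restrict_support[of B, where 'a = 'a]] by (simp add: finite_PiE)

lemma card_supported:
  "finite B \<Longrightarrow> card {f::'b \<Rightarrow> 'a::{zero,finite}. {x. f x \<noteq> 0} \<subseteq> B} = CARD('a) ^ card B"
  using bij_betw_same_card[OF bij_betw_restrict_support[of B]] by (simp add: card_PiE)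

lemma vec_eq_supported: "vec n = {f. {x. f x \<noteq> 0} \<subseteq> {..<n}}"
  by (auto simp: vec_def subset_iff not_le[symmetric])

lemma finite_vec [simp]: "finite (vec n :: (nat \<Rightarrow> 'a::{zero,finite}) set)"
  by (simp add: vec_eq_supported finite_supported)

lemma card_vec: "card (vec n :: (nat \<Rightarrow> 'a::{zero,finite}) set) = CARD('a) ^ n"
  by (simp add: vec_eq_supported card_supported)

lemma card_field_gt_1: "1 < CARD('a::{field,finite})"
proof -
  have "card {0, 1::'a} \<le> CARD('a)" by (intro card_mono) auto
  then show ?thesis by simp
qed

subsection \<open>Transversal subspaces\<close>

text \<open>
  For a word over an alphabet of subspaces \<open>W\<close> that are transversal to the kernel of \<open>\<pi>\<close>, with
  sections \<open>s W\<close> of \<open>\<pi>\<close> onto \<open>W\<close>, a combinatorial line becomes a linear embedding into a fibre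
  power over \<open>\<pi>\<close>: moving coordinates copy the point, fixed coordinates apply a section to its
  projection.
\<close>

definition sections :: "((nat \<Rightarrow> 'a::field) \<Rightarrow> nat \<Rightarrow> 'a) \<Rightarrow> (nat \<Rightarrow> 'a) set set \<Rightarrow>
    ((nat \<Rightarrow> 'a) set \<Rightarrow> (nat \<Rightarrow> 'a) \<Rightarrow> nat \<Rightarrow> 'a) \<Rightarrow> bool" where
  "sections \<pi> \<Omega> s \<longleftrightarrow> (\<forall>W\<in>\<Omega>. lin (s W) \<and> (\<forall>x. \<pi> (s W (\<pi> x)) = \<pi> x) \<and> (\<forall>w\<in>W. s W (\<pi> w) = w))"

definition line_map :: "('v \<Rightarrow> 'v) \<Rightarrow> ('b \<Rightarrow> 'v \<Rightarrow> 'v) \<Rightarrow> 'b option list \<Rightarrow> nat \<Rightarrow> 'v \<Rightarrow> 'v" where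
  "line_map \<pi> s w j b = (case w ! j of None \<Rightarrow> b | Some W \<Rightarrow> s W (\<pi> b))"

lemma sections_exist:
  assumes "lin \<pi>" "\<And>W. W \<in> \<Omega> \<Longrightarrow> subsp W \<and> inj_on \<pi> W"
  shows "\<exists>s. sections \<pi> \<Omega> s"
proof -
  have "\<forall>W\<in>\<Omega>. \<exists>t. lin t \<and> (\<forall>x. \<pi> (t (\<pi> x)) = \<pi> x) \<and> (\<forall>w\<in>W. t (\<pi> w) = w)"
  proof
    fix W assume "W \<in> \<Omega>"
    then have "subsp W" "inj_on \<pi> W" using assms(2) by auto
    then show "\<exists>t. lin t \<and> (\<forall>x. \<pi> (t (\<pi> x)) = \<pi> x) \<and> (\<forall>w\<in>W. t (\<pi> w) = w)"
      by (rule linear_section[OF assms(1)]) fast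
  qed
  then show ?thesis unfolding sections_def by (rule bchoice)
qed

lemma line_nth:
  assumes "w \<in> lines \<Omega> m" "j < m"
  obtains "w ! j = None" | W where "W \<in> \<Omega>" "w ! j = Some W"
proof -
  have "w ! j \<in> insert None (Some ` \<Omega>)"
    by (rule subsetD[of "set w"]) (use assms in \<open>auto simp: lines_def\<close>)
  then show thesis using that by blast
qed

lemma line_moving:
  assumes "w \<in> lines \<Omega> m"
  obtains j where "j < m" "w ! j = None"
  using assms by (auto simp: lines_def in_set_conv_nth)

lemma line_map_fill:
  assumes "sections \<pi> \<Omega> s" "w \<in> lines \<Omega> m" "W \<in> \<Omega>" "b \<in> W" "j < m"
  shows "line_map \<pi> s w j b = s (fill W w ! j) (\<pi> b)"
  using assms by (auto simp: line_map_def fill_def sections_def lines_def split: option.split)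

lemma lin_line_map:
  assumes "lin \<pi>" "sections \<pi> \<Omega> s" "w \<in> lines \<Omega> m" "j < m"
  shows "lin (line_map \<pi> s w j)"
  using assms(3,4)
proof (cases rule: line_nth)
  case 1
  then have "line_map \<pi> s w j = (\<lambda>b. b)" by (simp add: line_map_def fun_eq_iff)
  then show ?thesis using lin_id(2) by simp
next
  case (2 W)
  then have "lin (s W)" using assms(2) by (simp add: sections_def)
  moreover have "line_map \<pi> s w j = (\<lambda>b. s W (\<pi> b))" using 2 by (simp add: line_map_def fun_eq_iff)
  ultimately show ?thesis using lin_compose[OF _ assms(1)] by simp
qed

lemma proj_line_map:
  assumes "sections \<pi> \<Omega> s" "w \<in> lines \<Omega> m" "j < m"
  shows "\<pi> (line_map \<pi> s w j b) = \<pi> b"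
  using assms(2,3)
  by (cases rule: line_nth) (use assms(1) in \<open>auto simp: line_map_def sections_def\<close>)

section \<open>Hales--Jewett for sections: colours that depend on the projection only\<close>

lemma trunc_trunc: "trunc u (trunc (u + d) x) = trunc u x"
  by (simp add: trunc_def fun_eq_iff)

text \<open>The bound on \<open>c\<close> is asked at every argument so that \<open>c\<close> can
  itself serve as an \<open>r\<close>-colouring. For \<open>u = 0\<close> the projection forgets
  coordinate 0, hence the guard on that clause.\<close>

definition colour_factor :: "nat \<Rightarrow> nat \<Rightarrow> nat \<Rightarrow> nat \<Rightarrow> ((nat \<Rightarrow> 'a::field) set \<Rightarrow> nat) \<Rightarrow>
    ((nat \<Rightarrow> 'a) \<Rightarrow> nat \<Rightarrow> 'a) \<Rightarrow> ((nat \<Rightarrow> 'a) set \<Rightarrow> nat) \<Rightarrow> bool" where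
  "colour_factor r u d N \<chi> \<psi> c \<longleftrightarrow>
     lin \<psi> \<and> inj_on \<psi> (vec (u + d)) \<and> \<psi> ` vec (u + d) \<subseteq> vec N \<and>
     (0 < u \<longrightarrow> (\<forall>x. \<psi> x 0 = x 0)) \<and> (\<forall>Z. c Z < r) \<and>
     (\<forall>W. subsp W \<and> W \<subseteq> vec (u + d) \<and> inj_on (trunc u) W \<longrightarrow> \<chi> (\<psi> ` W) = c (trunc u ` W))"

lemma colour_factorD:
  assumes "colour_factor r u d N \<chi> \<psi> c"
  shows "lin \<psi>" and "inj_on \<psi> (vec (u + d))" and "\<psi> ` vec (u + d) \<subseteq> vec N"
    and "0 < u \<Longrightarrow> \<psi> x 0 = x 0" and "c Z < r"
    and "subsp W \<Longrightarrow> W \<subseteq> vec (u + d) \<Longrightarrow> inj_on (trunc u) W \<Longrightarrow> \<chi> (\<psi> ` W) = c (trunc u ` W)"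
  using assms[unfolded colour_factor_def] by auto

text \<open>The letters are all transversal subspaces, read as sections. For each set
  \<open>Z\<close> in the base, a word is coloured by the colour of the image of \<open>Z\<close>
  under its sections. A line that is monochromatic for all \<open>Z\<close> at once is an embedding
  along which only the projection \<open>Z\<close> of a subspace matters.\<close>

lemma transversal_colours:
  assumes r: "0 < r"
  shows "\<exists>N. \<forall>\<chi> :: (nat \<Rightarrow> 'a::{field,finite}) set \<Rightarrow> nat. (\<forall>W. \<chi> W < r) \<longrightarrow>
    (\<exists>\<psi> c. colour_factor r u d N \<chi> \<psi> c)"
proof -
  define \<Omega> where "\<Omega> = {W :: (nat \<Rightarrow> 'a) set. subsp W \<and> W \<subseteq> vec (u + d) \<and> inj_on (trunc u) W}"
  have \<Omega>: "subsp W" "W \<subseteq> vec (u + d)" "inj_on (trunc u) W" if "W \<in> \<Omega>" for W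
    using that by (simp_all add: \<Omega>_def)
  have fin: "finite \<Omega>" by (rule finite_subset[of _ "Pow (vec (u + d))"]) (auto simp: \<Omega>_def)
  have "{0} \<in> \<Omega>" by (auto simp: vec_def \<Omega>_def)
  then have ne: "\<Omega> \<noteq> {}" by blast
  obtain s0 where s0: "sections (trunc u) \<Omega> s0"
    using sections_exist[OF lin_trunc, of \<Omega> u] \<Omega> by blast
  \<comment> \<open>Truncation keeps the section inside \<open>vec (u + d)\<close> and changes
    neither its projection nor its values in \<open>W\<close>.\<close>
  define s where "s W x = trunc (u + d) (s0 W x)" for W x
  have s: "sections (trunc u) \<Omega> s"
    unfolding sections_def
  proof (intro ballI conjI allI)
    fix W assume W: "W \<in> \<Omega>"
    show "lin (s W)" unfolding s_def
      by (rule lin_compose[OF lin_trunc]) (use W s0 in \<open>simp add: sections_def\<close>)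
    show "trunc u (s W (trunc u x)) = trunc u x" for x
      using W s0 by (simp add: s_def trunc_trunc sections_def)
    fix w assume "w \<in> W"
    then have "s0 W (trunc u w) = w" "w \<in> vec (u + d)" using W s0 \<Omega>(2)[OF W] by (auto simp: sections_def)
    then show "s W (trunc u w) = w" by (simp add: s_def)
  qed
  define Y where "Y = Pow (vec u :: (nat \<Rightarrow> 'a) set)"
  have "finite Y" by (simp add: Y_def)
  from hales_jewett_simultaneous[OF hales_jewett[OF fin ne] this r] obtain m where
    m: "\<And>\<chi>. \<forall>v x. \<chi> v x < r \<Longrightarrow> \<exists>w\<in>lines \<Omega> m. \<forall>v\<in>Y. \<exists>c. \<forall>a\<in>\<Omega>. \<chi> v (fill a w) = c"
    by blast
  show ?thesis
  proof (rule exI[of _ "m * (u + d)"], intro allI impI)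
    fix \<chi> :: "(nat \<Rightarrow> 'a) set \<Rightarrow> nat" assume bd: "\<forall>W. \<chi> W < r"
    define P where "P x Z = (\<lambda>v. inter m (\<lambda>j. s (x ! j) v)) ` Z" for x Z
    have "\<forall>Z x. \<chi> (P x Z) < r" using bd by simp
    from m[OF this] obtain w where w: "w \<in> lines \<Omega> m"
      and mono: "\<forall>Z\<in>Y. \<exists>c. \<forall>W\<in>\<Omega>. \<chi> (P (fill W w) Z) = c"
      by blast
    from bchoice[OF mono] obtain c where c: "\<forall>Z\<in>Y. \<forall>W\<in>\<Omega>. \<chi> (P (fill W w) Z) = c Z"
      by blast
    define e where "e b = inter m (\<lambda>j. line_map (trunc u) s w j b)" for b
    obtain j0 where j0: "j0 < m" "w ! j0 = None" by (rule line_moving[OF w])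
    have pj0: "part m j0 (e b) = b" for b
      using j0 by (simp add: e_def line_map_def)
    have lin_e: "lin e"
      unfolding e_def by (rule lin_inter) (use j0(1) lin_line_map[OF lin_trunc s w] in auto)
    have "inj e" by (rule inj_on_inverseI[of _ "part m j0"]) (rule pj0)
    have in_vec: "line_map (trunc u) s w j b \<in> vec (u + d)" if "b \<in> vec (u + d)" "j < m" for j b
      using w that(2) by (cases rule: line_nth) (use that(1) in \<open>auto simp: line_map_def s_def\<close>)
    have e_vec: "e ` vec (u + d) \<subseteq> vec (m * (u + d))"
      unfolding e_def using j0(1) in_vec by (auto intro!: inter_in_vec)
    \<comment> \<open>Every component of \<open>e x\<close> has the projection of \<open>x\<close>,
      hence the same coordinate 0 once \<open>u\<close> is positive.\<close>
    have e0: "e x 0 = x 0" if "0 < u" for x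
    proof -
      have "trunc u (line_map (trunc u) s w 0 x) 0 = trunc u x 0"
        using proj_line_map[OF s w, of 0 x] j0(1) by simp
      then show ?thesis using that by (simp add: trunc_def e_def)
    qed
    have eW: "e ` W = P (fill W w) (trunc u ` W)" if W: "W \<in> \<Omega>" for W
    proof -
      have "e b = inter m (\<lambda>j. s (fill W w ! j) (trunc u b))" if "b \<in> W" for b
        unfolding e_def using j0(1) line_map_fill[OF s w W that] by (intro inter_cong) auto
      then show ?thesis unfolding P_def image_image by (rule image_cong[OF refl])
    qed
    \<comment> \<open>Outside \<open>Y\<close> the chosen \<open>c\<close> is arbitrary; the default
      0 restores the bound there.\<close>
    let ?c = "\<lambda>Z. if c Z < r then c Z else 0"
    have col: "\<chi> (e ` W) = ?c (trunc u ` W)" if W: "W \<in> \<Omega>" for W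
    proof -
      have "trunc u ` W \<in> Y" by (auto simp: Y_def)
      then have "\<chi> (P (fill W w) (trunc u ` W)) = c (trunc u ` W)"
        using bspec[OF bspec[OF c] W] by simp
      then have "\<chi> (e ` W) = c (trunc u ` W)" by (simp only: eW[OF W])
      moreover have "\<chi> (e ` W) < r" using bd by blast
      ultimately show ?thesis by simp
    qed
    show "\<exists>\<psi> c. colour_factor r u d (m * (u + d)) \<chi> \<psi> c"
      unfolding colour_factor_def
    proof (intro exI[of _ e] exI[of _ ?c] conjI)
      show "inj_on e (vec (u + d))" using \<open>inj e\<close> by (rule inj_on_subset) simp
      show "\<forall>W. subsp W \<and> W \<subseteq> vec (u + d) \<and> inj_on (trunc u) W \<longrightarrow> \<chi> (e ` W) = ?c (trunc u ` W)"
        using col by (simp add: \<Omega>_def)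
    qed (use lin_e e_vec e0 r in auto)
  qed
qed

subsection \<open>Ramsey theorem for spaces\<close>

definition emb :: "bool \<Rightarrow> nat \<Rightarrow> nat \<Rightarrow> ((nat \<Rightarrow> 'a::field) \<Rightarrow> nat \<Rightarrow> 'a) \<Rightarrow> bool" where
  "emb A n N \<psi> \<longleftrightarrow> lin \<psi> \<and> inj_on \<psi> (vec n) \<and> \<psi> ` vec n \<subseteq> vec N \<and> (A \<longrightarrow> (\<forall>x\<in>vec n. \<psi> x 0 = x 0))"

text \<open>
  Over a finite field the rank of a subspace is read off its cardinality. Affine spaces are
  homogenised: coordinate \<open>0\<close> is the functional whose level set \<open>1\<close> is the affine space, so
  that for \<open>A = True\<close> only subspaces meeting this level set count.
\<close>

definition grass :: "bool \<Rightarrow> nat \<Rightarrow> nat \<Rightarrow> (nat \<Rightarrow> 'a::{field,finite}) set set" where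
  "grass A k n = {W. subsp W \<and> W \<subseteq> vec n \<and> card W = CARD('a) ^ k \<and> (A \<longrightarrow> (\<exists>x\<in>W. x 0 \<noteq> 0))}"

lemma emb_id: "n \<le> N \<Longrightarrow> emb A n N (\<lambda>x. x)"
  using vec_mono[of n N] by (auto simp: emb_def lin_id)

lemma emb_compose:
  assumes "emb A n m \<phi>" "emb A m N \<psi>"
  shows "emb A n N (\<lambda>x. \<psi> (\<phi> x))"
  using assms lin_compose[of \<psi> \<phi>] unfolding emb_def
  by (auto simp: inj_on_def image_subset_iff)

lemma emb_mono: "emb A n N \<psi> \<Longrightarrow> n' \<le> n \<Longrightarrow> N \<le> N' \<Longrightarrow> emb A n' N' \<psi>"
  using vec_mono[of n' n] vec_mono[of N N'] inj_on_subset[of \<psi> "vec n" "vec n'"]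
  by (auto simp: emb_def)

lemma emb_grass:
  assumes "emb A n N \<psi>" "W \<in> grass A k n"
  shows "\<psi> ` W \<in> grass A k N"
proof -
  have "W \<subseteq> vec n" using assms by (simp add: grass_def)
  then have "card (\<psi> ` W) = card W" using assms inj_on_subset by (intro card_image) (auto simp: emb_def)
  then show ?thesis
    using assms subsp_image[of \<psi> W] \<open>W \<subseteq> vec n\<close> by (auto simp: grass_def emb_def subset_iff)
qed

lemma grass_empty: "n < k \<Longrightarrow> grass A k n = ({} :: (nat \<Rightarrow> 'a::{field,finite}) set set)"
proof -
  assume "n < k"
  have False if "W \<in> grass A k n" for W :: "(nat \<Rightarrow> 'a) set"
  proof -
    have "W \<subseteq> vec n" "card W = CARD('a) ^ k" using that by (simp_all add: grass_def)
    then have "CARD('a) ^ k \<le> CARD('a) ^ n"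
      using card_mono[OF finite_vec, of W n] by (simp add: card_vec)
    moreover have "CARD('a) ^ n < CARD('a) ^ k"
      using \<open>n < k\<close> card_field_gt_1 by (rule power_strict_increasing)
    ultimately show False by simp
  qed
  then show ?thesis by blast
qed

lemma grass_mono: "n \<le> N \<Longrightarrow> grass A k n \<subseteq> grass A k N"
  using vec_mono[of n N] by (auto simp: grass_def)

section \<open>Cones and extension of embeddings by one dimension\<close>

definition unit :: "nat \<Rightarrow> nat \<Rightarrow> 'a::field" where
  "unit u = (\<lambda>i. if i = u then 1 else 0)"

definition cone :: "nat \<Rightarrow> (nat \<Rightarrow> 'a::field) set \<Rightarrow> (nat \<Rightarrow> 'a) set" where
  "cone u Z = (\<lambda>(z, a). z + fun_scale a (unit u)) ` (Z \<times> UNIV)"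

definition extend :: "((nat \<Rightarrow> 'a::field) \<Rightarrow> nat \<Rightarrow> 'a) \<Rightarrow> nat \<Rightarrow> nat \<Rightarrow> (nat \<Rightarrow> 'a) \<Rightarrow> nat \<Rightarrow> 'a" where
  "extend \<phi> n u x = \<phi> (trunc n x) + fun_scale (x n) (unit u)"

lemma lin_extend: "lin \<phi> \<Longrightarrow> lin (extend \<phi> n u)"
  by (rule linI)
     (simp_all add: extend_def lin_add[OF lin_trunc] lin_scale[OF lin_trunc] lin_add lin_scale
        fun_eq_iff algebra_simps)

lemma vec_Suc_decompose: "x \<in> vec (Suc n) \<Longrightarrow> x = trunc n x + fun_scale (x n) (unit n)"
proof
  fix i assume "x \<in> vec (Suc n)"
  then show "x i = (trunc n x + fun_scale (x n) (unit n)) i"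
    by (cases "i < n"; cases "i = n") (auto simp: trunc_def unit_def vec_def)
qed

text \<open>\<open>0 < u\<close> keeps the added basis vector away from coordinate 0, and in the
  affine case \<open>0 < n\<close> leaves coordinate 0 in the part of the argument that
  \<open>\<phi>\<close> sees.\<close>

lemma emb_extend:
  assumes e: "emb A n u \<phi>" and u: "0 < u" and n: "A \<Longrightarrow> 0 < n"
  shows "emb A (Suc n) (Suc u) (extend \<phi> n u)"
  unfolding emb_def
proof (intro conjI impI ballI)
  have \<phi>: "lin \<phi>" "inj_on \<phi> (vec n)" "\<And>x. x \<in> vec n \<Longrightarrow> \<phi> x \<in> vec u"
    "\<And>x. A \<Longrightarrow> x \<in> vec n \<Longrightarrow> \<phi> x 0 = x 0"
    using e by (auto simp: emb_def)
  show "lin (extend \<phi> n u)" by (rule lin_extend[OF \<phi>(1)])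
  have tu: "trunc u (extend \<phi> n u x) = \<phi> (trunc n x)" for x
    using \<phi>(3)[OF trunc_in_vec, of x]
    by (auto simp: fun_eq_iff extend_def trunc_def unit_def vec_def)
  have cu: "extend \<phi> n u x u = x n" for x
    using \<phi>(3)[OF trunc_in_vec, of x] by (simp add: extend_def unit_def vec_def)
  show "inj_on (extend \<phi> n u) (vec (Suc n))"
  proof (rule inj_onI)
    fix x y :: "nat \<Rightarrow> 'a"
    assume xy: "x \<in> vec (Suc n)" "y \<in> vec (Suc n)" and eq: "extend \<phi> n u x = extend \<phi> n u y"
    have "\<phi> (trunc n x) = \<phi> (trunc n y)" using tu[of x] tu[of y] eq by simp
    from inj_onD[OF \<phi>(2), OF this] have "trunc n x = trunc n y" by simp
    moreover have "x n = y n" using cu[of x] cu[of y] eq by simp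
    ultimately show "x = y" using vec_Suc_decompose[OF xy(1)] vec_Suc_decompose[OF xy(2)] by simp
  qed
  show "extend \<phi> n u ` vec (Suc n) \<subseteq> vec (Suc u)"
    using \<phi>(3)[OF trunc_in_vec] by (auto simp: extend_def vec_def unit_def)
  fix x :: "nat \<Rightarrow> 'a" assume "A" "x \<in> vec (Suc n)"
  then show "extend \<phi> n u x 0 = x 0"
    using \<phi>(4)[OF _ trunc_in_vec, of x] u n by (simp add: extend_def trunc_def unit_def)
qed

lemma trunc_extend:
  assumes "emb A n u \<phi>"
  shows "trunc u (extend \<phi> n u x) = \<phi> (trunc n x)"
proof -
  have "\<phi> (trunc n x) \<in> vec u" using assms by (auto simp: emb_def)
  then show ?thesis by (auto simp: fun_eq_iff extend_def trunc_def unit_def vec_def)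
qed

lemma extend_cone:
  assumes "lin \<phi>" "Z \<subseteq> vec n"
  shows "extend \<phi> n u ` cone n Z = cone u (\<phi> ` Z)"
proof -
  have "extend \<phi> n u (z + fun_scale a (unit n)) = \<phi> z + fun_scale a (unit u)" if "z \<in> Z" for z a
  proof -
    have z: "z \<in> vec n" using that assms by blast
    have "trunc n (z + fun_scale a (unit n)) = z"
      using z by (auto simp: trunc_def vec_def unit_def fun_eq_iff)
    moreover have "(z + fun_scale a (unit n)) n = a" using z by (simp add: vec_def unit_def)
    ultimately show ?thesis by (simp add: extend_def)
  qed
  then show ?thesis unfolding cone_def by (force simp: image_iff)
qed

text \<open>The two cases are whether the last basis vector lies in \<open>W\<close>. If so,
  \<open>W\<close> is a cone over a base of rank one less. If not, on \<open>W\<close> the last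
  coordinate is determined by the others, so \<open>trunc n\<close> preserves the rank. The affine
  condition passes to the projection because coordinate 0 is not the one removed.\<close>

lemma grass_Suc_cases:
  fixes W :: "(nat \<Rightarrow> 'a::{field,finite}) set"
  assumes W: "W \<in> grass A (Suc k) (Suc n)" and n: "A \<longrightarrow> 0 < n"
  obtains "W = cone n (trunc n ` W)" "trunc n ` W \<in> grass A k n"
  | "inj_on (trunc n) W" "trunc n ` W \<in> grass A (Suc k) n"
proof -
  let ?Z = "trunc n ` W"
  have W': "subsp W" "W \<subseteq> vec (Suc n)" "card W = CARD('a) ^ Suc k"
    using W by (simp_all add: grass_def)
  have dec: "w = trunc n w + fun_scale (w n) (unit n)" if "w \<in> W" for w
    using vec_Suc_decompose that W'(2) by blast
  have sub: "subsp ?Z" by (rule subsp_image[OF lin_trunc W'(1)])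
  have Zvec: "?Z \<subseteq> vec n" by auto
  have good: "A \<longrightarrow> (\<exists>x\<in>?Z. x 0 \<noteq> 0)"
    using W n by (auto simp: grass_def trunc_def)
  show thesis
  proof (cases "unit n \<in> W")
    case True
    have ZW: "trunc n w \<in> W" if "w \<in> W" for w
    proof -
      have "w - fun_scale (w n) (unit n) \<in> W"
        using fs.vs1.subspace_diff[OF W'(1) that] fs.vs1.subspace_scale[OF W'(1) True] by blast
      moreover have "w - fun_scale (w n) (unit n) = trunc n w"
        using dec[OF that] by (metis add_diff_cancel_right')
      ultimately show ?thesis by simp
    qed
    have cone: "W = cone n ?Z"
    proof
      show "W \<subseteq> cone n ?Z"
      proof
        fix w assume w: "w \<in> W"
        show "w \<in> cone n ?Z"
          unfolding cone_def
          by (rule image_eqI[of _ _ "(trunc n w, w n)"]) (use w dec[OF w] in auto)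
      qed
      show "cone n ?Z \<subseteq> W"
        unfolding cone_def
        using ZW fs.vs1.subspace_add[OF W'(1)] fs.vs1.subspace_scale[OF W'(1) True] by auto
    qed
    have "inj_on (\<lambda>(z, a). z + fun_scale a (unit n)) (?Z \<times> UNIV)"
    proof (rule inj_onI, clarify)
      fix x y a b assume eq: "trunc n x + fun_scale a (unit n) = trunc n y + fun_scale b (unit n)"
      have "a = b" using fun_cong[OF eq, of n] by (simp add: trunc_def unit_def)
      then show "trunc n x = trunc n y \<and> a = b" using eq by simp
    qed
    from card_image[OF this] have "card W = card ?Z * CARD('a)"
      by (subst cone) (simp add: cone_def card_cartesian_product)
    then have "card ?Z = CARD('a) ^ k" using W'(3) by simp
    then show thesis using that(1) cone sub Zvec good by (simp add: grass_def)
  next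
    case False
    have inj: "inj_on (trunc n) W"
    proof (rule inj_onI)
      fix x y assume x: "x \<in> W" and y: "y \<in> W" and eq: "trunc n x = trunc n y"
      have d: "x - y = fun_scale (x n - y n) (unit n)"
        using dec[OF x] dec[OF y] eq by (metis add_diff_cancel_left fs.vs1.scale_left_diff_distrib)
      have "x - y \<in> W" using fs.vs1.subspace_diff[OF W'(1) x y] .
      then have "fun_scale (inverse (x n - y n)) (x - y) \<in> W" by (rule fs.vs1.subspace_scale[OF W'(1)])
      then have "x n - y n \<noteq> 0 \<Longrightarrow> unit n \<in> W" by (simp add: d)
      then have "x n = y n" using False by auto
      then show "x = y" using dec[OF x] dec[OF y] eq by simp
    qed
    then have "card ?Z = CARD('a) ^ Suc k" using W'(3) card_image by metis
    then show thesis using that(2) inj sub Zvec good by (simp add: grass_def)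
  qed
qed

lemma grass_0: "W \<in> grass A 0 n \<Longrightarrow> W = {0}"
  using fs.vs1.subspace_0[of W] by (auto simp: grass_def card_1_singleton_iff)

text \<open>Seen from coordinate 0 all affine points look alike: each is a graph over
  \<open>vec 1\<close>. This lets \<open>transversal_colours\<close> with \<open>u = 1\<close>
  settle affine rank 1 by itself.\<close>

lemma trunc_1_grass:
  fixes W :: "(nat \<Rightarrow> 'a::{field,finite}) set"
  assumes "W \<in> grass True 1 n"
  shows "inj_on (trunc 1) W \<and> trunc 1 ` W = vec 1"
proof -
  obtain x where x: "x \<in> W" "x 0 \<noteq> 0" and W: "subsp W" "card W = CARD('a)" "W \<subseteq> vec n"
    using assms by (auto simp: grass_def)
  have eq: "trunc 1 ` W = vec 1"
  proof
    show "vec 1 \<subseteq> trunc 1 ` W"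
    proof
      fix y :: "nat \<Rightarrow> 'a" assume "y \<in> vec 1"
      then have "y = trunc 1 (fun_scale (y 0 / x 0) x)"
        using x(2) by (auto simp: trunc_def vec_def fun_eq_iff)
      then show "y \<in> trunc 1 ` W" using fs.vs1.subspace_scale[OF W(1) x(1)] by blast
    qed
  qed auto
  have "finite W" using finite_subset[OF W(3) finite_vec] .
  then have "inj_on (trunc 1) W"
    by (rule eq_card_imp_inj_on) (simp only: eq card_vec W(2) power_one_right)
  with eq show ?thesis by blast
qed

section \<open>Off-diagonal Ramsey theorem for subspaces\<close>

definition mono_emb :: "bool \<Rightarrow> nat \<Rightarrow> nat \<Rightarrow> nat \<Rightarrow> ((nat \<Rightarrow> 'a::{field,finite}) set \<Rightarrow> nat) \<Rightarrow> nat \<Rightarrow> bool" where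
  "mono_emb A k n N \<chi> i \<longleftrightarrow> (\<exists>\<psi>. emb A n N \<psi> \<and> (\<forall>W\<in>grass A k n. \<chi> (\<psi> ` W) = i))"

lemma mono_emb_mono: "mono_emb A k n N \<chi> i \<Longrightarrow> n' \<le> n \<Longrightarrow> N \<le> N' \<Longrightarrow> mono_emb A k n' N' \<chi> i"
  unfolding mono_emb_def using emb_mono grass_mono by blast

text \<open>Each colour \<open>i\<close> has its own target dimension \<open>ns i\<close>, so that
  an induction can lower one target at a time. The \<open>itself\<close> argument fixes the field,
  which no other argument mentions.\<close>

definition ramsey_spaces :: "'a::{field,finite} itself \<Rightarrow> bool \<Rightarrow> nat \<Rightarrow> nat \<Rightarrow> (nat \<Rightarrow> nat) \<Rightarrow> nat \<Rightarrow> bool" where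
  "ramsey_spaces _ A r k ns N \<longleftrightarrow> (\<forall>\<chi> :: (nat \<Rightarrow> 'a) set \<Rightarrow> nat. (\<forall>W. \<chi> W < r) \<longrightarrow>
     (\<exists>i<r. mono_emb A k (ns i) N \<chi> i))"

lemma ramsey_spaces_mono: "ramsey_spaces T A r k ns N \<Longrightarrow> N \<le> N' \<Longrightarrow> ramsey_spaces T A r k ns N'"
  unfolding ramsey_spaces_def using mono_emb_mono[OF _ order_refl] by blast

lemma ramsey_spaces_0: "ramsey_spaces TYPE('a::{field,finite}) A r 0 ns (sum ns {..<r})"
  unfolding ramsey_spaces_def
proof (intro allI impI)
  fix \<chi> :: "(nat \<Rightarrow> 'a) set \<Rightarrow> nat" assume b: "\<forall>W. \<chi> W < r"
  show "\<exists>i<r. mono_emb A 0 (ns i) (sum ns {..<r}) \<chi> i"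
  proof (intro exI[of _ "\<chi> {0}"] conjI)
    show i: "\<chi> {0} < r" using b by blast
    then have "ns (\<chi> {0}) \<le> sum ns {..<r}" by (intro member_le_sum) auto
    from emb_id[OF this] show "mono_emb A 0 (ns (\<chi> {0})) (sum ns {..<r}) \<chi> (\<chi> {0})"
      unfolding mono_emb_def by (intro exI[of _ "\<lambda>x. x"]) (auto dest: grass_0)
  qed
qed

text \<open>All points have the same projection \<open>vec 1\<close>, so \<open>c (vec 1)\<close> is
  the common colour. The sum of all targets bounds whichever target this colour asks for.\<close>

lemma ramsey_spaces_affine_points:
  assumes r: "0 < r"
  shows "\<exists>N. ramsey_spaces TYPE('a::{field,finite}) True r 1 ns N"
proof -
  let ?d = "sum ns {..<r}"
  obtain N where N: "\<forall>\<chi> :: (nat \<Rightarrow> 'a) set \<Rightarrow> nat. (\<forall>W. \<chi> W < r) \<longrightarrow>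
    (\<exists>\<psi> c. colour_factor r 1 ?d N \<chi> \<psi> c)"
    using transversal_colours[OF r] by blast
  have "ramsey_spaces TYPE('a) True r 1 ns N"
    unfolding ramsey_spaces_def
  proof (intro allI impI)
    fix \<chi> :: "(nat \<Rightarrow> 'a) set \<Rightarrow> nat" assume b: "\<forall>W. \<chi> W < r"
    from N[THEN spec, THEN mp, OF b] obtain \<psi> c where f: "colour_factor r 1 ?d N \<chi> \<psi> c" by blast
    note \<psi> = colour_factorD[OF f]
    let ?i = "c (vec 1)"
    have "ns ?i \<le> ?d" using \<psi>(5) by (intro member_le_sum) auto
    then have le: "ns ?i \<le> 1 + ?d" by simp
    have "emb True (1 + ?d) N \<psi>" using \<psi>(1-4) by (simp add: emb_def)
    from emb_mono[OF this le order_refl] have e: "emb True (ns ?i) N \<psi>" .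
    have "\<chi> (\<psi> ` W) = ?i" if W: "W \<in> grass True 1 (ns ?i)" for W
    proof -
      have "subsp W" "W \<subseteq> vec (1 + ?d)"
        using W vec_mono[OF le] by (auto simp: grass_def)
      then show ?thesis using \<psi>(6)[of W] trunc_1_grass[OF W] by simp
    qed
    then have "mono_emb True 1 (ns ?i) N \<chi> ?i" unfolding mono_emb_def using e by blast
    then show "\<exists>i<r. mono_emb True 1 (ns i) N \<chi> i" using \<psi>(5) by blast
  qed
  then show ?thesis by blast
qed

text \<open>Along an embedding of \<open>vec (u + 1)\<close>, transversal subspaces are coloured
  through their projection by \<open>c\<close>. The other subspaces of rank \<open>Suc k\<close> are
  cones, coloured through their bases of rank \<open>k\<close>; \<open>outer\<close> gives these
  cones one colour \<open>i\<close> on a copy of \<open>vec M\<close>. There \<open>inner\<close> is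
  applied to \<open>c\<close>. If it returns a colour other than \<open>i\<close>, its copy is
  already large enough; if it returns \<open>i\<close>, adding the cone direction regains the
  dimension that was given away.\<close>

lemma ramsey_spaces_step:
  fixes M :: nat
  assumes r: "0 < r" and A: "A \<Longrightarrow> 0 < k" and ns: "\<And>i. i < r \<Longrightarrow> k < ns i"
    and inner: "\<And>i. i < r \<Longrightarrow> ramsey_spaces TYPE('a::{field,finite}) A r (Suc k) (ns(i := ns i - 1)) M"
    and outer: "ramsey_spaces TYPE('a) A r k (\<lambda>_. M) u" and u: "0 < u"
  shows "\<exists>N. ramsey_spaces TYPE('a) A r (Suc k) ns N"
proof -
  obtain N where N: "\<forall>\<chi> :: (nat \<Rightarrow> 'a) set \<Rightarrow> nat. (\<forall>W. \<chi> W < r) \<longrightarrow>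
    (\<exists>\<psi> c. colour_factor r u 1 N \<chi> \<psi> c)"
    using transversal_colours[OF r] by blast
  have "ramsey_spaces TYPE('a) A r (Suc k) ns N"
    unfolding ramsey_spaces_def
  proof (intro allI impI)
    fix \<chi> :: "(nat \<Rightarrow> 'a) set \<Rightarrow> nat" assume b: "\<forall>W. \<chi> W < r"
    from N[THEN spec, THEN mp, OF b] obtain \<psi>1 c where f: "colour_factor r u 1 N \<chi> \<psi>1 c" by blast
    note c = colour_factorD(5)[OF f] and col = colour_factorD(6)[OF f]
    have e1: "emb A (Suc u) N \<psi>1" using colour_factorD(1-4)[OF f] u by (simp add: emb_def)
    have "\<forall>Z. \<chi> (\<psi>1 ` cone u Z) < r" using b by blast
    then obtain i where i: "i < r" and "mono_emb A k M u (\<lambda>Z. \<chi> (\<psi>1 ` cone u Z)) i"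
      using outer unfolding ramsey_spaces_def by meson
    then obtain \<psi>2 where e2: "emb A M u \<psi>2"
      and col2: "\<And>Z. Z \<in> grass A k M \<Longrightarrow> \<chi> (\<psi>1 ` cone u (\<psi>2 ` Z)) = i"
      unfolding mono_emb_def by blast
    let ?ns = "ns(i := ns i - 1)"
    have "\<forall>Z. c (\<psi>2 ` Z) < r" using c by blast
    then obtain j where j: "j < r" and "mono_emb A (Suc k) (?ns j) M (\<lambda>Z. c (\<psi>2 ` Z)) j"
      using inner[OF i] unfolding ramsey_spaces_def by meson
    then obtain \<psi>3 where e3: "emb A (?ns j) M \<psi>3"
      and col3: "\<And>Z. Z \<in> grass A (Suc k) (?ns j) \<Longrightarrow> c (\<psi>2 ` \<psi>3 ` Z) = j"
      unfolding mono_emb_def by blast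
    define \<phi> where "\<phi> x = \<psi>2 (\<psi>3 x)" for x
    have e: "emb A (?ns j) u \<phi>" unfolding \<phi>_def by (rule emb_compose[OF e3 e2])
    have im: "\<phi> ` Z = \<psi>2 ` \<psi>3 ` Z" for Z by (simp add: \<phi>_def image_image)
    show "\<exists>i<r. mono_emb A (Suc k) (ns i) N \<chi> i"
    proof (cases "j = i")
      case False
      have ns_j: "?ns j = ns j" using False by simp
      have "\<chi> ((\<lambda>x. \<psi>1 (\<phi> x)) ` W) = j" if W: "W \<in> grass A (Suc k) (ns j)" for W
      proof -
        have "\<phi> ` W \<in> grass A (Suc k) u" using emb_grass[OF e] W ns_j by simp
        then have g: "subsp (\<phi> ` W)" "\<phi> ` W \<subseteq> vec u" by (simp_all add: grass_def)
        then have tr: "trunc u x = x" if "x \<in> \<phi> ` W" for x using that by auto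
        then have "trunc u ` \<phi> ` W = \<phi> ` W" by simp
        moreover have "inj_on (trunc u) (\<phi> ` W)" by (rule inj_on_inverseI[of _ "\<lambda>x. x"]) (rule tr)
        moreover have "\<phi> ` W \<subseteq> vec (u + 1)" by (rule order_trans[OF g(2) vec_mono]) simp
        ultimately have "\<chi> (\<psi>1 ` \<phi> ` W) = c (\<phi> ` W)" using col[OF g(1)] by simp
        also have "\<dots> = j" using col3[of W] W by (simp only: im ns_j)
        finally show ?thesis by (simp only: image_image)
      qed
      moreover have "emb A (ns j) N (\<lambda>x. \<psi>1 (\<phi> x))"
        using emb_compose[OF _ e1] emb_mono[OF e order_refl, of "Suc u"] ns_j by simp
      ultimately show ?thesis using j unfolding mono_emb_def by blast
    next
      case True
      define n where "n = ns i - 1"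
      have n: "?ns j = n" "ns i = Suc n" "k \<le> n" using True ns[OF i] by (simp_all add: n_def)
      have An: "0 < n" if A using A[OF that] n by simp
      have e': "emb A n u \<phi>" using e n by simp
      let ?\<phi> = "extend \<phi> n u"
      have ee: "emb A (Suc n) (Suc u) ?\<phi>" by (rule emb_extend[OF e' u An])
      have "\<chi> ((\<lambda>x. \<psi>1 (?\<phi> x)) ` W) = i" if W: "W \<in> grass A (Suc k) (Suc n)" for W
      proof (rule grass_Suc_cases[OF W])
        show "A \<longrightarrow> 0 < n" using An by blast
      next
        let ?Z = "trunc n ` W"
        assume 1: "W = cone n ?Z" "?Z \<in> grass A k n"
        have "lin \<phi>" using e by (simp add: emb_def)
        then have "?\<phi> ` cone n ?Z = cone u (\<phi> ` ?Z)" by (rule extend_cone) auto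
        then have "?\<phi> ` W = cone u (\<phi> ` ?Z)" by (simp only: 1(1)[symmetric])
        moreover have "\<psi>3 ` ?Z \<in> grass A k M" using emb_grass[OF e3] 1(2) n by simp
        ultimately have "\<chi> (\<psi>1 ` ?\<phi> ` W) = i" using col2 by (simp add: im)
        then show ?thesis by (simp add: image_image)
      next
        let ?Z = "trunc n ` W"
        assume 2: "inj_on (trunc n) W" "?Z \<in> grass A (Suc k) n"
        have "?\<phi> ` W \<in> grass A (Suc k) (Suc u)" by (rule emb_grass[OF ee W])
        then have g: "subsp (?\<phi> ` W)" "?\<phi> ` W \<subseteq> vec (u + 1)" by (simp_all add: grass_def)
        have t: "trunc u ` ?\<phi> ` W = \<phi> ` ?Z"
          by (simp add: image_image trunc_extend[OF e'])
        have "inj_on (trunc u) (?\<phi> ` W)"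
        proof (rule inj_onI, clarify)
          fix x y assume x: "x \<in> W" and y: "y \<in> W" and eq: "trunc u (?\<phi> x) = trunc u (?\<phi> y)"
          then have "\<phi> (trunc n x) = \<phi> (trunc n y)" by (simp add: trunc_extend[OF e'])
          moreover have "inj_on \<phi> (vec n)" using e' by (simp add: emb_def)
          ultimately have "trunc n x = trunc n y" by (meson inj_onD trunc_in_vec)
          then show "?\<phi> x = ?\<phi> y" using 2(1) x y by (metis inj_onD)
        qed
        from col[OF g this] have "\<chi> (\<psi>1 ` ?\<phi> ` W) = c (\<phi> ` ?Z)" by (simp only: t)
        also have "\<dots> = i" using col3[of ?Z] 2(2) n True by (simp add: im)
        finally show ?thesis by (simp only: image_image)
      qed
      moreover have "emb A (Suc n) N (\<lambda>x. \<psi>1 (?\<phi> x))" by (rule emb_compose[OF ee e1])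
      ultimately have "mono_emb A (Suc k) (ns i) N \<chi> i" unfolding mono_emb_def n(2) by blast
      with i show ?thesis by blast
    qed
  qed
  then show ?thesis by blast
qed

text \<open>Induction on the sum of the targets. It stops when some \<open>ns i \<le> k\<close>: in
  that dimension there is nothing of rank \<open>Suc k\<close> to colour, and the identity embedding
  serves.\<close>

lemma ramsey_spaces_Suc:
  assumes r: "0 < r" and A: "A \<Longrightarrow> 0 < k"
    and outer: "\<And>ns. \<exists>N. ramsey_spaces TYPE('a::{field,finite}) A r k ns N"
  shows "\<exists>N. ramsey_spaces TYPE('a) A r (Suc k) ns N"
proof (induction "sum ns {..<r}" arbitrary: ns rule: less_induct)
  case less
  show ?case
  proof (cases "\<exists>i<r. ns i \<le> k")
    case True
    then obtain i where i: "i < r" "ns i \<le> k" by blast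
    then have "grass A (Suc k) (ns i) = ({} :: (nat \<Rightarrow> 'a) set set)" by (simp add: grass_empty)
    then have "mono_emb A (Suc k) (ns i) (ns i) \<chi> i" for \<chi> :: "(nat \<Rightarrow> 'a) set \<Rightarrow> nat"
      unfolding mono_emb_def using emb_id[OF order_refl] by blast
    then show ?thesis unfolding ramsey_spaces_def using i by blast
  next
    case False
    have "\<forall>i\<in>{..<r}. \<exists>N. ramsey_spaces TYPE('a) A r (Suc k) (ns(i := ns i - 1)) N"
    proof (rule ballI, rule less)
      fix i assume i: "i \<in> {..<r}"
      show "sum (ns(i := ns i - 1)) {..<r} < sum ns {..<r}"
      proof (rule sum_strict_mono_ex1)
        have "0 < ns i" using False i by auto
        then show "\<exists>j\<in>{..<r}. (ns(i := ns i - 1)) j < ns j"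
          using i by (intro bexI[of _ i]) auto
      qed auto
    qed
    from bchoice[OF this] obtain f
      where f: "\<forall>i\<in>{..<r}. ramsey_spaces TYPE('a) A r (Suc k) (ns(i := ns i - 1)) (f i)" ..
    define M where "M = sum f {..<r}"
    have M: "ramsey_spaces TYPE('a) A r (Suc k) (ns(i := ns i - 1)) M" if "i < r" for i
    proof (rule ramsey_spaces_mono)
      show "ramsey_spaces TYPE('a) A r (Suc k) (ns(i := ns i - 1)) (f i)" using f that by blast
      show "f i \<le> M" unfolding M_def using that by (intro member_le_sum) auto
    qed
    obtain u where "ramsey_spaces TYPE('a) A r k (\<lambda>_. M) u" using outer by blast
    \<comment> \<open>The successor secures the positive base dimension that the step
      requires.\<close>
    then have u: "ramsey_spaces TYPE('a) A r k (\<lambda>_. M) (Suc u)" by (rule ramsey_spaces_mono) simp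
    show ?thesis
      by (rule ramsey_spaces_step[OF r A _ M u]) (use False in \<open>auto simp: not_le\<close>)
  qed
qed

theorem ramsey_spaces:
  assumes r: "0 < r" and "A \<Longrightarrow> 0 < k"
  shows "\<exists>N. ramsey_spaces TYPE('a::{field,finite}) A r k ns N"
  using assms(2)
proof (induction k arbitrary: ns)
  case 0
  then show ?case using ramsey_spaces_0 by blast
next
  case (Suc k)
  show ?case
  proof (cases "A \<and> k = 0")
    case True
    then show ?thesis using ramsey_spaces_affine_points[OF r] by simp
  next
    case False
    then show ?thesis using Suc by (intro ramsey_spaces_Suc[OF r]) auto
  qed
qed

text \<open>A finite set of embeddings suffices since only their restrictions to the finite set \<open>vec n\<close> matter.\<close>

corollary ramsey_embeddings:
  assumes r: "0 < r" and A: "A \<Longrightarrow> 0 < k"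
  shows "\<exists>\<Psi> :: ((nat \<Rightarrow> 'a::{field,finite}) \<Rightarrow> nat \<Rightarrow> 'a) set. finite \<Psi> \<and>
    (\<forall>\<psi>\<in>\<Psi>. lin \<psi> \<and> inj_on \<psi> (vec n) \<and> (A \<longrightarrow> (\<forall>x\<in>vec n. \<psi> x 0 = x 0))) \<and>
    (\<forall>\<chi> :: (nat \<Rightarrow> 'a) set \<Rightarrow> nat. (\<forall>W. \<chi> W < r) \<longrightarrow>
      (\<exists>\<psi>\<in>\<Psi>. \<exists>i. \<forall>W\<in>grass A k n. \<chi> (\<psi> ` W) = i))"
proof -
  obtain N where N: "ramsey_spaces TYPE('a) A r k (\<lambda>_. n) N" using ramsey_spaces[OF assms] by blast
  let ?E = "{\<psi> :: (nat \<Rightarrow> 'a) \<Rightarrow> nat \<Rightarrow> 'a. emb A n N \<psi>}"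
  let ?res = "\<lambda>\<psi> :: (nat \<Rightarrow> 'a) \<Rightarrow> nat \<Rightarrow> 'a. restrict \<psi> (vec n)"
  \<comment> \<open>\<open>inv_into\<close> picks one embedding for each restriction to
    \<open>vec n\<close>.\<close>
  define \<Psi> where "\<Psi> = inv_into ?E ?res ` ?res ` ?E"
  have "?res ` ?E \<subseteq> PiE (vec n) (\<lambda>_. vec N)" by (auto simp: emb_def)
  then have "finite (?res ` ?E)" by (rule finite_subset) (simp add: finite_PiE)
  then have "finite \<Psi>" unfolding \<Psi>_def by (rule finite_imageI)
  moreover have "\<Psi> \<subseteq> ?E" unfolding \<Psi>_def by (intro image_subsetI inv_into_into)
  then have "\<forall>\<psi>\<in>\<Psi>. lin \<psi> \<and> inj_on \<psi> (vec n) \<and> (A \<longrightarrow> (\<forall>x\<in>vec n. \<psi> x 0 = x 0))"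
    by (auto simp: emb_def)
  moreover have "\<exists>\<psi>\<in>\<Psi>. \<exists>i. \<forall>W\<in>grass A k n. \<chi> (\<psi> ` W) = i" if b: "\<forall>W. \<chi> W < r"
    for \<chi> :: "(nat \<Rightarrow> 'a) set \<Rightarrow> nat"
  proof -
    from N[unfolded ramsey_spaces_def, THEN spec, THEN mp, OF b]
    obtain i where "mono_emb A k n N \<chi> i" by blast
    then obtain \<psi> where e: "emb A n N \<psi>" and i: "\<forall>W\<in>grass A k n. \<chi> (\<psi> ` W) = i"
      unfolding mono_emb_def by blast
    define \<psi>' where "\<psi>' = inv_into ?E ?res (?res \<psi>)"
    have res: "?res \<psi> \<in> ?res ` ?E" using e by blast
    from f_inv_into_f[OF this] have "?res \<psi>' = ?res \<psi>" by (simp only: \<psi>'_def)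
    from fun_cong[OF this] have eq: "\<psi>' x = \<psi> x" if "x \<in> vec n" for x
      using that by (metis restrict_apply')
    have "\<chi> (\<psi>' ` W) = i" if W: "W \<in> grass A k n" for W
    proof -
      have "W \<subseteq> vec n" using W by (simp add: grass_def)
      then have "\<psi>' ` W = \<psi> ` W" by (intro image_cong eq) auto
      then show ?thesis using i W by simp
    qed
    moreover have "\<psi>' \<in> \<Psi>" unfolding \<Psi>_def \<psi>'_def using res by (rule imageI)
    ultimately show ?thesis by blast
  qed
  ultimately show ?thesis by (intro exI[of _ \<Psi>] conjI allI impI)
qed

subsection \<open>The partite construction\<close>

text \<open>The analogue of a partite hypergraph: the fibres of \<open>\<pi>\<close> are the parts,
  and injectivity says that an edge meets each part at most once. The common cardinality
  \<open>c\<close> stands for a common rank.\<close>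

definition partite_system :: "nat \<Rightarrow> ((nat \<Rightarrow> 'a::field) \<Rightarrow> nat \<Rightarrow> 'a) \<Rightarrow> (nat \<Rightarrow> 'a) set set \<Rightarrow> bool" where
  "partite_system c \<pi> H \<longleftrightarrow> lin \<pi> \<and> finite H \<and> (\<forall>W\<in>H. subsp W \<and> card W = c \<and> inj_on \<pi> W)"

text \<open>A copy over the same base. Inducedness is asked of every set \<open>W\<close>, so that
  no stray member of \<open>H'\<close> can sit inside the copy.\<close>

definition system_emb :: "((nat \<Rightarrow> 'a::field) \<Rightarrow> nat \<Rightarrow> 'a) \<Rightarrow> (nat \<Rightarrow> 'a) set set \<Rightarrow>
    ((nat \<Rightarrow> 'a) \<Rightarrow> nat \<Rightarrow> 'a) \<Rightarrow> (nat \<Rightarrow> 'a) set set \<Rightarrow> ((nat \<Rightarrow> 'a) \<Rightarrow> nat \<Rightarrow> 'a) \<Rightarrow> bool" where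
  "system_emb \<pi> H \<pi>' H' e \<longleftrightarrow>
     lin e \<and> inj e \<and> (\<forall>x. \<pi>' (e x) = \<pi> x) \<and> (\<forall>W. e ` W \<in> H' \<longleftrightarrow> W \<in> H)"

lemma system_emb_id: "system_emb \<pi> H \<pi> H (\<lambda>x. x)"
  by (simp add: system_emb_def lin_id)

lemma system_emb_compose:
  assumes "system_emb \<pi> H \<pi>' H' e" "system_emb \<pi>' H' \<pi>'' H'' e'"
  shows "system_emb \<pi> H \<pi>'' H'' (\<lambda>x. e' (e x))"
proof -
  have "(\<lambda>x. e' (e x)) ` W = e' ` e ` W" for W by (simp add: image_image)
  then show ?thesis
    using assms lin_compose[of e' e] inj_compose[of e' e] unfolding system_emb_def comp_def by simp
qed

definition partite_ramsey :: "nat \<Rightarrow> (nat \<Rightarrow> 'a) set set \<Rightarrow> ((nat \<Rightarrow> 'a::field) \<Rightarrow> nat \<Rightarrow> 'a) \<Rightarrow>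
    (nat \<Rightarrow> 'a) set set \<Rightarrow> ((nat \<Rightarrow> 'a) \<Rightarrow> nat \<Rightarrow> 'a) \<Rightarrow> (nat \<Rightarrow> 'a) set set \<Rightarrow> bool" where
  "partite_ramsey r \<Y> \<pi> H \<pi>' H' \<longleftrightarrow> (\<forall>\<chi> :: (nat \<Rightarrow> 'a) set \<Rightarrow> nat. (\<forall>W. \<chi> W < r) \<longrightarrow>
     (\<exists>e. system_emb \<pi> H \<pi>' H' e \<and> (\<forall>Y\<in>\<Y>. \<exists>a. \<forall>W\<in>H. \<pi> ` W = Y \<longrightarrow> \<chi> (e ` W) = a)))"

lemmas partite_ramseyD = partite_ramsey_def[THEN iffD1, THEN spec, THEN mp]

text \<open>
  There is one copy of the system for each line. Besides the fibre power there is one extra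
  coordinate per line, holding \<open>\<theta>\<close> of the projection; as \<open>\<theta>\<close> has kernel \<open>Y\<close>, different copies
  meet above \<open>Y\<close> only.
\<close>

lemma partite_step:
  fixes \<pi> :: "(nat \<Rightarrow> 'a::{field,finite}) \<Rightarrow> nat \<Rightarrow> 'a"
  assumes sys: "partite_system c \<pi> H" and c: "0 < c" and r: "0 < r"
  shows "\<exists>\<pi>' H'. partite_system c \<pi>' H' \<and> partite_ramsey r {Y} \<pi> H \<pi>' H'"
proof (cases "\<exists>W\<in>H. \<pi> ` W = Y")
  case False
  then have "partite_ramsey r {Y} \<pi> H \<pi> H"
    using system_emb_id[of \<pi> H] by (auto simp: partite_ramsey_def)
  then show ?thesis using sys by blast
next
  case True
  have lin_\<pi>: "lin \<pi>" and finH: "finite H"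
    and H: "\<And>W. W \<in> H \<Longrightarrow> subsp W" "\<And>W. W \<in> H \<Longrightarrow> card W = c" "\<And>W. W \<in> H \<Longrightarrow> inj_on \<pi> W"
    using sys by (auto simp: partite_system_def)
  \<comment> \<open>The alphabet consists of the members above \<open>Y\<close> only, but their
    sections are defined over the whole range of \<open>\<pi>\<close>; hence a line embeds the
    entire system.\<close>
  define \<Omega> where "\<Omega> = {W \<in> H. \<pi> ` W = Y}"
  have \<Omega>: "W \<in> H" "\<pi> ` W = Y" if "W \<in> \<Omega>" for W using that by (auto simp: \<Omega>_def)
  have fin: "finite \<Omega>" using finH by (simp add: \<Omega>_def)
  obtain W1 where W1: "W1 \<in> \<Omega>" using True by (auto simp: \<Omega>_def)
  have Y: "subsp Y" "card Y = c"
    using subsp_image[OF lin_\<pi> H(1)] card_image[OF H(3)] H(2) \<Omega>[OF W1] by auto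
  have finY: "finite Y" using Y(2) c card.infinite[of Y] by auto
  obtain s where s: "sections \<pi> \<Omega> s"
    using sections_exist[OF lin_\<pi>, of \<Omega>] H(1,3) \<Omega>(1) by blast
  obtain \<theta> :: "(nat \<Rightarrow> 'a) \<Rightarrow> nat \<Rightarrow> 'a" where \<theta>: "lin \<theta>" "\<And>v. \<theta> v = 0 \<longleftrightarrow> v \<in> Y"
    using linear_with_kernel[OF Y(1)] by blast
  have "hales_jewett \<Omega>" using hales_jewett[OF fin] W1 by blast
  then obtain m where m: "\<And>\<chi>. \<forall>x. \<chi> x < r \<Longrightarrow> \<exists>w\<in>lines \<Omega> m. \<exists>a. \<forall>W\<in>\<Omega>. \<chi> (fill W w) = a"
    using r unfolding hales_jewett_def by blast
  have "\<exists>w. w \<in> lines \<Omega> m" using m[of "\<lambda>_. 0"] r by blast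
  then obtain w0 where "w0 \<in> lines \<Omega> m" ..
  then obtain j0 where "j0 < m" by (rule line_moving)
  then have m0: "0 < m" by simp
  let ?L = "lines \<Omega> m"
  obtain g :: "(nat \<Rightarrow> 'a) set option list \<Rightarrow> nat" and T
    where g: "g ` ?L = {i. i < T}" and inj_g: "inj_on g ?L"
    using finite_imp_inj_to_nat_seg[OF finite_lines[OF fin, of m]] by blast
  have gT: "g w < T" if "w \<in> ?L" for w using g that by blast
  define e where "e w b = inter (m + T)
    (\<lambda>j. if j < m then line_map \<pi> s w j b else if j = m + g w then \<theta> (\<pi> b) else 0)" for w b
  have M0: "0 < m + T" using m0 by simp
  have part_e: "part (m + T) j (e w b) = line_map \<pi> s w j b" if "j < m" for j w b
    using that by (simp add: e_def)
  have part_tag: "part (m + T) (m + j) (e w b) = (if j = g w then \<theta> (\<pi> b) else 0)" if "j < T" for j w b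
    using that by (simp add: e_def)
  have lin_e: "lin (e w)" if w: "w \<in> ?L" for w
    unfolding e_def
  proof (rule lin_inter[OF M0])
    fix j assume "j < m + T"
    show "lin (\<lambda>b. if j < m then line_map \<pi> s w j b else if j = m + g w then \<theta> (\<pi> b) else 0)"
      using lin_line_map[OF lin_\<pi> s w] lin_compose[OF \<theta>(1) lin_\<pi>] lin_zero
      by (cases "j < m"; cases "j = m + g w") simp_all
  qed
  have inj_e: "inj (e w)" if w: "w \<in> ?L" for w
  proof -
    obtain j0 where j0: "j0 < m" "w ! j0 = None" by (rule line_moving[OF w])
    show ?thesis
      by (rule inj_on_inverseI[of _ "part (m + T) j0"]) (simp add: part_e[OF j0(1)] line_map_def j0(2))
  qed
  \<comment> \<open>On each copy all components below \<open>m\<close> have the same projection;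
    component 0 is one choice.\<close>
  define \<pi>' where "\<pi>' f = \<pi> (part (m + T) 0 f)" for f
  have \<pi>'_e: "\<pi>' (e w b) = \<pi> b" if w: "w \<in> ?L" for w b
    using proj_line_map[OF s w m0] by (simp add: \<pi>'_def part_e[OF m0])
  have lin_\<pi>': "lin \<pi>'" unfolding \<pi>'_def by (rule lin_compose[OF lin_\<pi> lin_part])
  define H' where "H' = (\<Union>w\<in>?L. (`) (e w) ` H)"
  have sys': "partite_system c \<pi>' H'"
    unfolding partite_system_def
  proof (intro conjI ballI lin_\<pi>')
    show "finite H'" unfolding H'_def using finite_lines[OF fin] finH by blast
    fix W assume "W \<in> H'"
    then obtain w W0 where w: "w \<in> ?L" and W0: "W0 \<in> H" and W: "W = e w ` W0"
      unfolding H'_def by blast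
    show "subsp W" unfolding W by (rule subsp_image[OF lin_e[OF w] H(1)[OF W0]])
    have "inj_on (e w) W0" using inj_e[OF w] by (rule inj_on_subset) simp
    then show "card W = c" unfolding W using H(2)[OF W0] by (simp add: card_image)
    show "inj_on \<pi>' W"
      unfolding W using H(3)[OF W0] by (auto simp: inj_on_def \<pi>'_e[OF w])
  qed
  have induced: "e w ` W \<in> H' \<longleftrightarrow> W \<in> H" if w: "w \<in> ?L" for w W
  proof
    assume "W \<in> H" then show "e w ` W \<in> H'" unfolding H'_def using w by blast
  next
    assume "e w ` W \<in> H'"
    then obtain w' W0 where w': "w' \<in> ?L" and W0: "W0 \<in> H" and eq: "e w ` W = e w' ` W0"
      unfolding H'_def by blast
    show "W \<in> H"
    proof (cases "w = w'")
      case True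
      then show ?thesis using eq W0 inj_image_eq_iff[OF inj_e[OF w]] by simp
    next
      case False
      then have gne: "g w' \<noteq> g w" using inj_onD[OF inj_g _ w' w] by auto
      \<comment> \<open>The tag of \<open>w'\<close> is zero throughout the copy for
        \<open>w\<close>, so a set in both copies projects into \<open>Y\<close>, and onto
        \<open>Y\<close> by counting.\<close>
      have "\<pi> x0 \<in> Y" if x0: "x0 \<in> W0" for x0
      proof -
        have "e w' x0 \<in> e w ` W" using x0 by (simp add: eq)
        then obtain x where "e w' x0 = e w x" by blast
        then have "part (m + T) (m + g w') (e w' x0) = part (m + T) (m + g w') (e w x)" by simp
        then have "\<theta> (\<pi> x0) = 0" using part_tag[OF gT[OF w']] gne by simp
        then show ?thesis using \<theta>(2) by blast
      qed
      then have "\<pi> ` W0 \<subseteq> Y" by blast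
      moreover have "card (\<pi> ` W0) = card Y" using card_image[OF H(3)[OF W0]] H(2)[OF W0] Y(2) by simp
      ultimately have W0Y: "\<pi> ` W0 = Y" using finY by (intro card_subset_eq)
      \<comment> \<open>A component that moves along \<open>w\<close> returns \<open>W\<close>
        itself. Along \<open>w'\<close> that component either moves as well and gives
        \<open>W0\<close>, or it is the section of a letter \<open>Z\<close> and gives
        \<open>Z\<close>; both are members of \<open>H\<close>.\<close>
      obtain j0 where j0: "j0 < m" "w ! j0 = None" by (rule line_moving[OF w])
      have "W = part (m + T) j0 ` e w ` W"
        by (simp only: image_image part_e[OF j0(1)]) (simp add: line_map_def j0(2))
      also have "\<dots> = line_map \<pi> s w' j0 ` W0"
        by (simp only: eq image_image part_e[OF j0(1)])
      finally have W: "W = line_map \<pi> s w' j0 ` W0" .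
      from w' j0(1) show ?thesis
      proof (cases rule: line_nth)
        case 1
        then show ?thesis using W W0 by (simp add: line_map_def)
      next
        case (2 Z)
        have "W = s Z ` \<pi> ` W0" unfolding W by (simp add: line_map_def 2(2) image_image)
        also have "\<dots> = s Z ` \<pi> ` Z" using W0Y \<Omega>(2)[OF 2(1)] by simp
        also have "\<dots> = (\<lambda>z. z) ` Z" unfolding image_image
          by (rule image_cong[OF refl]) (use s 2(1) in \<open>simp add: sections_def\<close>)
        finally show ?thesis using \<Omega>(1)[OF 2(1)] by simp
      qed
    qed
  qed
  have "\<exists>e. system_emb \<pi> H \<pi>' H' e \<and> (\<forall>Z\<in>{Y}. \<exists>a. \<forall>W\<in>H. \<pi> ` W = Z \<longrightarrow> \<chi> (e ` W) = a)"
    if bd: "\<forall>W. \<chi> W < r" for \<chi> :: "(nat \<Rightarrow> 'a) set \<Rightarrow> nat"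
  proof -
    \<comment> \<open>Above \<open>Y\<close> all tags are zero, so the image of a letter is
      determined by a word of sections alone and words can be coloured by it.\<close>
    define P where "P x = (\<lambda>v. inter (m + T) (\<lambda>j. if j < m then s (x ! j) v else 0)) ` Y" for x
    have "\<forall>x. \<chi> (P x) < r" using bd by blast
    from m[OF this] obtain w a where w: "w \<in> ?L" and a: "\<forall>W\<in>\<Omega>. \<chi> (P (fill W w)) = a" by blast
    have "e w ` W = P (fill W w)" if W: "W \<in> \<Omega>" for W
    proof -
      have "e w b = inter (m + T) (\<lambda>j. if j < m then s (fill W w ! j) (\<pi> b) else 0)" if b: "b \<in> W" for b
        unfolding e_def
      proof (rule inter_cong[OF M0])
        have "\<pi> b \<in> Y" using b \<Omega>(2)[OF W] by blast
        then have "\<theta> (\<pi> b) = 0" using \<theta>(2) by blast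
        then show "(if j < m then line_map \<pi> s w j b else if j = m + g w then \<theta> (\<pi> b) else 0) =
            (if j < m then s (fill W w ! j) (\<pi> b) else 0)" for j
          using line_map_fill[OF s w W b] by simp
      qed
      then have "e w ` W = (\<lambda>b. inter (m + T) (\<lambda>j. if j < m then s (fill W w ! j) (\<pi> b) else 0)) ` W"
        by (rule image_cong[OF refl])
      then show ?thesis unfolding P_def \<Omega>(2)[OF W, symmetric] image_image .
    qed
    then have "\<forall>W\<in>H. \<pi> ` W = Y \<longrightarrow> \<chi> (e w ` W) = a" using a by (simp add: \<Omega>_def)
    moreover have "system_emb \<pi> H \<pi>' H' (e w)"
      using lin_e[OF w] inj_e[OF w] \<pi>'_e[OF w] induced[OF w] by (simp add: system_emb_def)
    ultimately show ?thesis by blast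
  qed
  then have "partite_ramsey r {Y} \<pi> H \<pi>' H'" by (simp add: partite_ramsey_def)
  with sys' show ?thesis by blast
qed

text \<open>Systems are built in one order, copies are chosen in the reverse one: the copy in the
  last system comes first, the colouring is pulled back to it, and the earlier stages choose inside.
  Constancy above \<open>Y\<close> survives, since the inner embeddings commute with the projections
  and send members to members.\<close>

lemma partite_iterate:
  fixes \<pi> :: "(nat \<Rightarrow> 'a::{field,finite}) \<Rightarrow> nat \<Rightarrow> 'a"
  assumes "finite \<Y>" and sys: "partite_system c \<pi> H" and c: "0 < c" and r: "0 < r"
  shows "\<exists>\<pi>' H'. partite_system c \<pi>' H' \<and> partite_ramsey r \<Y> \<pi> H \<pi>' H'"
  using assms(1)
proof (induction \<Y>)
  case empty
  have "partite_ramsey r {} \<pi> H \<pi> H"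
    using system_emb_id[of \<pi> H] by (auto simp: partite_ramsey_def)
  then show ?case using sys by blast
next
  case (insert Y \<Y>)
  from insert.IH obtain \<pi>1 H1 where sys1: "partite_system c \<pi>1 H1" and 1: "partite_ramsey r \<Y> \<pi> H \<pi>1 H1"
    by blast
  from partite_step[OF sys1 c r, of Y] obtain \<pi>2 H2 where sys2: "partite_system c \<pi>2 H2"
    and 2: "partite_ramsey r {Y} \<pi>1 H1 \<pi>2 H2" by blast
  have "\<exists>e. system_emb \<pi> H \<pi>2 H2 e \<and> (\<forall>Y\<in>insert Y \<Y>. \<exists>a. \<forall>W\<in>H. \<pi> ` W = Y \<longrightarrow> \<chi> (e ` W) = a)"
    if bd: "\<forall>W. \<chi> W < r" for \<chi> :: "(nat \<Rightarrow> 'a) set \<Rightarrow> nat"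
  proof -
    from partite_ramseyD[OF 2 bd] obtain e2 where e2: "system_emb \<pi>1 H1 \<pi>2 H2 e2"
      and ex: "\<forall>Z\<in>{Y}. \<exists>a. \<forall>W\<in>H1. \<pi>1 ` W = Z \<longrightarrow> \<chi> (e2 ` W) = a" by (elim exE conjE) (rule that)
    from bspec[OF ex singletonI] obtain a where a: "\<forall>W\<in>H1. \<pi>1 ` W = Y \<longrightarrow> \<chi> (e2 ` W) = a" ..
    have "\<forall>W. \<chi> (e2 ` W) < r" using bd by blast
    from partite_ramseyD[OF 1 this] obtain e1 where e1: "system_emb \<pi> H \<pi>1 H1 e1"
      and b: "\<forall>Z\<in>\<Y>. \<exists>a. \<forall>W\<in>H. \<pi> ` W = Z \<longrightarrow> \<chi> (e2 ` e1 ` W) = a" by (elim exE conjE) (rule that)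
    have im: "(\<lambda>x. e2 (e1 x)) ` W = e2 ` e1 ` W" for W by (simp only: image_image)
    have "\<chi> (e2 ` e1 ` W) = a" if W: "W \<in> H" "\<pi> ` W = Y" for W
    proof -
      have "e1 ` W \<in> H1" using e1 W by (simp add: system_emb_def)
      moreover have "\<pi>1 ` e1 ` W = Y" using e1 W by (simp add: system_emb_def image_image)
      ultimately show ?thesis using a by blast
    qed
    then have bY: "\<exists>a. \<forall>W\<in>H. \<pi> ` W = Y \<longrightarrow> \<chi> (e2 ` e1 ` W) = a" by (intro exI[of _ a] ballI impI)
    have "\<forall>Y\<in>insert Y \<Y>. \<exists>a. \<forall>W\<in>H. \<pi> ` W = Y \<longrightarrow> \<chi> ((\<lambda>x. e2 (e1 x)) ` W) = a"
    proof
      fix Z assume "Z \<in> insert Y \<Y>"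
      then show "\<exists>a. \<forall>W\<in>H. \<pi> ` W = Z \<longrightarrow> \<chi> ((\<lambda>x. e2 (e1 x)) ` W) = a"
        unfolding im
      proof (rule insertE)
        assume "Z = Y" with bY show "\<exists>a. \<forall>W\<in>H. \<pi> ` W = Z \<longrightarrow> \<chi> (e2 ` e1 ` W) = a" by (simp only:)
      next
        assume "Z \<in> \<Y>" then show "\<exists>a. \<forall>W\<in>H. \<pi> ` W = Z \<longrightarrow> \<chi> (e2 ` e1 ` W) = a" by (rule bspec[OF b])
      qed
    qed
    with system_emb_compose[OF e1 e2] show ?thesis
      by (intro exI[of _ "\<lambda>x. e2 (e1 x)"] conjI)
  qed
  then have "partite_ramsey r (insert Y \<Y>) \<pi> H \<pi>2 H2" unfolding partite_ramsey_def by (intro allI impI)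
  then show ?case using sys2 by blast
qed

text \<open>Only the finitely many projections of members have to be treated. Their colours form a
  colouring \<open>d\<close> of the base, bounded everywhere so that the Ramsey theorem for spaces
  can be applied to it.\<close>

lemma partite_construction:
  fixes \<pi> :: "(nat \<Rightarrow> 'a::{field,finite}) \<Rightarrow> nat \<Rightarrow> 'a"
  assumes sys: "partite_system c \<pi> H" and c: "0 < c" and r: "0 < r"
  shows "\<exists>\<pi>' H'. partite_system c \<pi>' H' \<and> (\<forall>\<chi> :: (nat \<Rightarrow> 'a) set \<Rightarrow> nat. (\<forall>W. \<chi> W < r) \<longrightarrow>
     (\<exists>e d. system_emb \<pi> H \<pi>' H' e \<and> (\<forall>W. d W < r) \<and> (\<forall>W\<in>H. \<chi> (e ` W) = d (\<pi> ` W))))"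
proof -
  let ?Y = "(`) \<pi> ` H"
  have "finite ?Y" using sys by (simp add: partite_system_def)
  from partite_iterate[OF this sys c r] obtain \<pi>' H' where sys': "partite_system c \<pi>' H'"
    and *: "partite_ramsey r ?Y \<pi> H \<pi>' H'"
    by blast
  have "\<exists>e d. system_emb \<pi> H \<pi>' H' e \<and> (\<forall>W. d W < r) \<and> (\<forall>W\<in>H. \<chi> (e ` W) = d (\<pi> ` W))"
    if bd: "\<forall>W. \<chi> W < r" for \<chi> :: "(nat \<Rightarrow> 'a) set \<Rightarrow> nat"
  proof -
    from partite_ramseyD[OF * bd] obtain e where e: "system_emb \<pi> H \<pi>' H' e"
      and ex: "\<forall>Y\<in>?Y. \<exists>a. \<forall>W\<in>H. \<pi> ` W = Y \<longrightarrow> \<chi> (e ` W) = a" by (elim exE conjE) (rule that)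
    from bchoice[OF ex] obtain d where d: "\<forall>Y\<in>?Y. \<forall>W\<in>H. \<pi> ` W = Y \<longrightarrow> \<chi> (e ` W) = d Y" ..
    define d' where "d' Y = (if d Y < r then d Y else 0)" for Y
    have "\<forall>W\<in>H. \<chi> (e ` W) = d' (\<pi> ` W)"
    proof
      fix W assume "W \<in> H"
      then have "\<chi> (e ` W) = d (\<pi> ` W)" using d by simp
      moreover have "\<chi> (e ` W) < r" using bd by blast
      ultimately show "\<chi> (e ` W) = d' (\<pi> ` W)" by (simp add: d'_def)
    qed
    moreover have "\<forall>W. d' W < r" using r by (simp add: d'_def)
    ultimately show ?thesis using e by blast
  qed
  then have main: "\<forall>\<chi> :: (nat \<Rightarrow> 'a) set \<Rightarrow> nat. (\<forall>W. \<chi> W < r) \<longrightarrow>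
     (\<exists>e d. system_emb \<pi> H \<pi>' H' e \<and> (\<forall>W. d W < r) \<and> (\<forall>W\<in>H. \<chi> (e ` W) = d (\<pi> ` W)))"
    by (intro allI impI)
  show ?thesis by (rule exI[of _ \<pi>'], rule exI[of _ H'], rule conjI[OF sys' main])
qed

text \<open>The affine functional of the ambient space is coordinate 0 after \<open>\<pi>\<close>,
  because the embeddings of the partite construction are only known to preserve the
  projection.\<close>

definition induced_copy :: "bool \<Rightarrow> nat \<Rightarrow> (nat \<Rightarrow> 'a) set set \<Rightarrow> ((nat \<Rightarrow> 'a::field) \<Rightarrow> nat \<Rightarrow> 'a) \<Rightarrow>
    (nat \<Rightarrow> 'a) set set \<Rightarrow> ((nat \<Rightarrow> 'a) set \<Rightarrow> nat) \<Rightarrow> ((nat \<Rightarrow> 'a) \<Rightarrow> nat \<Rightarrow> 'a) \<Rightarrow> bool" where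
  "induced_copy A n F \<pi> H \<chi> \<psi> \<longleftrightarrow>
     lin \<psi> \<and> inj_on \<psi> (vec n) \<and> (A \<longrightarrow> (\<forall>x\<in>vec n. \<pi> (\<psi> x) 0 = x 0)) \<and>
     (\<forall>W. \<psi> ` W \<in> H \<longleftrightarrow> W \<in> F) \<and> (\<exists>a. \<forall>W\<in>F. \<chi> (\<psi> ` W) = a)"

text \<open>
  The initial system is the disjoint union of one copy of the family for each embedding \<open>\<psi>\<close>
  of \<open>vec n\<close>: a point carries its image under \<open>\<psi>\<close> and, in the slot of \<open>\<psi>\<close>, itself.
\<close>

lemma induced_ramsey_linear:
  fixes F :: "(nat \<Rightarrow> 'a::{field,finite}) set set"
  assumes r: "0 < r" and k: "0 < k" and F: "F \<subseteq> grass A k n"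
  shows "\<exists>(\<pi> :: (nat \<Rightarrow> 'a) \<Rightarrow> nat \<Rightarrow> 'a) H. lin \<pi> \<and> finite H \<and> (\<forall>W\<in>H. subsp W) \<and>
    (\<forall>\<chi> :: (nat \<Rightarrow> 'a) set \<Rightarrow> nat. (\<forall>W. \<chi> W < r) \<longrightarrow> (\<exists>\<psi>. induced_copy A n F \<pi> H \<chi> \<psi>))"
proof -
  obtain \<Psi> :: "((nat \<Rightarrow> 'a) \<Rightarrow> nat \<Rightarrow> 'a) set" where fin: "finite \<Psi>"
    and \<Psi>': "\<forall>\<psi>\<in>\<Psi>. lin \<psi> \<and> inj_on \<psi> (vec n) \<and> (A \<longrightarrow> (\<forall>x\<in>vec n. \<psi> x 0 = x 0))"
    and ram: "\<forall>\<chi> :: (nat \<Rightarrow> 'a) set \<Rightarrow> nat. (\<forall>W. \<chi> W < r) \<longrightarrow>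
      (\<exists>\<psi>\<in>\<Psi>. \<exists>i. \<forall>W\<in>grass A k n. \<chi> (\<psi> ` W) = i)"
    using ramsey_embeddings[where A = A and n = n, OF r k] by (elim exE conjE) (rule that)
  note \<Psi> = bspec[OF \<Psi>']
  obtain g :: "((nat \<Rightarrow> 'a) \<Rightarrow> nat \<Rightarrow> 'a) \<Rightarrow> nat" and T where g: "g ` \<Psi> = {i. i < T}" and inj_g: "inj_on g \<Psi>"
    using finite_imp_inj_to_nat_seg[OF fin] by blast
  have gT: "Suc (g \<psi>) < Suc T" if "\<psi> \<in> \<Psi>" for \<psi> using g that by blast
  \<comment> \<open>Component 0 holds the position in the base; the slots are shifted by one to
    leave it free.\<close>
  define s where "s \<psi> x = inter (Suc T) (\<lambda>j. if j = 0 then \<psi> x else if j = Suc (g \<psi>) then x else 0)"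
    for \<psi> :: "(nat \<Rightarrow> 'a) \<Rightarrow> nat \<Rightarrow> 'a" and x
  have part0: "part (Suc T) 0 (s \<psi> x) = \<psi> x" for \<psi> x by (simp add: s_def)
  have part_slot: "part (Suc T) (Suc (g \<psi>')) (s \<psi> x) = (if g \<psi>' = g \<psi> then x else 0)"
    if "\<psi>' \<in> \<Psi>" for \<psi> \<psi>' x
    using gT[OF that] by (simp add: s_def)
  have lin_s: "lin (s \<psi>)" if "\<psi> \<in> \<Psi>" for \<psi>
    unfolding s_def
  proof (rule lin_inter)
    fix j
    show "lin (\<lambda>b. if j = 0 then \<psi> b else if j = Suc (g \<psi>) then b else 0)"
      using \<Psi>[OF that] lin_id(2) lin_zero by (cases "j = 0"; cases "j = Suc (g \<psi>)") simp_all
  qed simp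
  have inj_s: "inj (s \<psi>)" if "\<psi> \<in> \<Psi>" for \<psi>
    by (rule inj_on_inverseI[of _ "part (Suc T) (Suc (g \<psi>))"]) (simp add: part_slot[OF that])
  have F': "subsp W" "W \<subseteq> vec n" "card W = CARD('a) ^ k" if "W \<in> F" for W
    using F that by (auto simp: grass_def)
  define H0 where "H0 = (\<Union>\<psi>\<in>\<Psi>. (`) (s \<psi>) ` F)"
  have "finite F" by (rule finite_subset[of _ "Pow (vec n)"]) (use F'(2) in auto)
  have sys: "partite_system (CARD('a) ^ k) (part (Suc T) 0) H0"
    unfolding partite_system_def
  proof (intro conjI ballI lin_part)
    show "finite H0" unfolding H0_def using fin \<open>finite F\<close> by blast
    fix W assume "W \<in> H0"
    then obtain \<psi> W0 where \<psi>: "\<psi> \<in> \<Psi>" and W0: "W0 \<in> F" and W: "W = s \<psi> ` W0" unfolding H0_def by blast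
    show "subsp W" unfolding W by (rule subsp_image[OF lin_s[OF \<psi>] F'(1)[OF W0]])
    have "inj_on (s \<psi>) W0" using inj_s[OF \<psi>] by (rule inj_on_subset) simp
    then show "card W = CARD('a) ^ k" unfolding W using F'(3)[OF W0] by (simp add: card_image)
    have "inj_on \<psi> W0" using \<Psi>[OF \<psi>] F'(2)[OF W0] inj_on_subset by blast
    then show "inj_on (part (Suc T) 0) W" unfolding W by (auto simp: inj_on_def part0)
  qed
  have induced0: "s \<psi> ` W \<in> H0 \<longleftrightarrow> W \<in> F" if \<psi>: "\<psi> \<in> \<Psi>" for \<psi> W
  proof
    assume "W \<in> F" then show "s \<psi> ` W \<in> H0" unfolding H0_def using \<psi> by blast
  next
    assume "s \<psi> ` W \<in> H0"
    then obtain \<psi>' W0 where \<psi>': "\<psi>' \<in> \<Psi>" and W0: "W0 \<in> F" and eq: "s \<psi> ` W = s \<psi>' ` W0"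
      unfolding H0_def by blast
    show "W \<in> F"
    proof (cases "\<psi> = \<psi>'")
      case True
      then show ?thesis using eq W0 inj_image_eq_iff[OF inj_s[OF \<psi>]] by simp
    next
      case False
      then have gne: "g \<psi>' \<noteq> g \<psi>" using inj_onD[OF inj_g _ \<psi>' \<psi>] by auto
      \<comment> \<open>Different copies meet in 0 only, whereas a member of positive rank has
        further points.\<close>
      have "x0 = 0" if x0: "x0 \<in> W0" for x0
      proof -
        have "s \<psi>' x0 \<in> s \<psi> ` W" using x0 by (simp add: eq)
        then obtain x where "s \<psi>' x0 = s \<psi> x" by blast
        then have "part (Suc T) (Suc (g \<psi>')) (s \<psi>' x0) = part (Suc T) (Suc (g \<psi>')) (s \<psi> x)" by simp
        then show ?thesis using gne by (simp add: part_slot[OF \<psi>'])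
      qed
      then have "W0 \<subseteq> {0}" by blast
      then have "card W0 \<le> card {0 :: nat \<Rightarrow> 'a}" by (intro card_mono) auto
      moreover have "1 < CARD('a) ^ k" using card_field_gt_1 k by (rule one_less_power)
      ultimately show ?thesis using F'(3)[OF W0] by simp
    qed
  qed
  have c0: "0 < CARD('a) ^ k" by simp
  obtain \<pi> H where sys': "partite_system (CARD('a) ^ k) \<pi> H"
    and *: "\<forall>\<chi> :: (nat \<Rightarrow> 'a) set \<Rightarrow> nat. (\<forall>W. \<chi> W < r) \<longrightarrow> (\<exists>e d. system_emb (part (Suc T) 0) H0 \<pi> H e \<and>
      (\<forall>W. d W < r) \<and> (\<forall>W\<in>H0. \<chi> (e ` W) = d (part (Suc T) 0 ` W)))"
    using partite_construction[OF sys c0 r] by (elim exE conjE) (rule that)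
  have "\<exists>\<psi>. induced_copy A n F \<pi> H \<chi> \<psi>"
    if bd: "\<forall>W. \<chi> W < r" for \<chi> :: "(nat \<Rightarrow> 'a) set \<Rightarrow> nat"
  proof -
    from *[THEN spec, THEN mp, OF bd] obtain e d where e: "system_emb (part (Suc T) 0) H0 \<pi> H e"
      and dr: "\<forall>W. d W < r" and d: "\<forall>W\<in>H0. \<chi> (e ` W) = d (part (Suc T) 0 ` W)"
      by (elim exE conjE) (rule that)
    \<comment> \<open>Applied to the colouring \<open>d\<close> of the base, the Ramsey theorem
      selects the copy in \<open>H0\<close> whose members all receive one colour.\<close>
    from ram[THEN spec, THEN mp, OF dr] obtain \<psi> i where \<psi>: "\<psi> \<in> \<Psi>" and i: "\<forall>W\<in>grass A k n. d (\<psi> ` W) = i"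
      by blast
    have e': "lin e" "inj e" "\<And>x. \<pi> (e x) = part (Suc T) 0 x" "\<And>W. e ` W \<in> H \<longleftrightarrow> W \<in> H0"
      using e by (simp_all add: system_emb_def)
    define \<phi> where "\<phi> x = e (s \<psi> x)" for x
    have im: "\<phi> ` W = e ` s \<psi> ` W" for W by (simp add: \<phi>_def image_image)
    have "lin \<phi>" unfolding \<phi>_def by (rule lin_compose[OF e'(1) lin_s[OF \<psi>]])
    moreover have "inj_on \<phi> (vec n)"
      using inj_compose[OF e'(2) inj_s[OF \<psi>]] unfolding \<phi>_def comp_def by (rule inj_on_subset) simp
    moreover have "A \<longrightarrow> (\<forall>x\<in>vec n. \<pi> (\<phi> x) 0 = x 0)"
      using \<Psi>[OF \<psi>] by (simp add: \<phi>_def e'(3) part0)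
    moreover have "\<forall>W. \<phi> ` W \<in> H \<longleftrightarrow> W \<in> F" by (simp only: im e'(4) induced0[OF \<psi>]) simp
    moreover have "\<chi> (\<phi> ` W) = i" if W: "W \<in> F" for W
    proof -
      have "s \<psi> ` W \<in> H0" using induced0[OF \<psi>] W by blast
      from bspec[OF d this] have "\<chi> (\<phi> ` W) = d (\<psi> ` W)" by (simp only: im image_image part0)
      also have "\<dots> = i" using i W F by blast
      finally show ?thesis .
    qed
    ultimately have "induced_copy A n F \<pi> H \<chi> \<phi>" unfolding induced_copy_def by blast
    then show ?thesis by (intro exI[of _ \<phi>])
  qed
  then have main: "\<forall>\<chi> :: (nat \<Rightarrow> 'a) set \<Rightarrow> nat. (\<forall>W. \<chi> W < r) \<longrightarrow> (\<exists>\<psi>. induced_copy A n F \<pi> H \<chi> \<psi>)"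
    by (intro allI impI)
  have "lin \<pi>" "finite H" "\<forall>W\<in>H. subsp W" using sys' by (auto simp: partite_system_def)
  with main show ?thesis by (rule_tac exI[of _ \<pi>], rule_tac exI[of _ H]) (intro conjI)
qed

subsection \<open>Spaces over a finite field\<close>

text \<open>The number of points of a \<open>k\<close>-space over a field with \<open>q\<close>
  elements. Affine rank is the affine dimension plus one, and the empty space has rank 0.\<close>

definition rank_card :: "nat \<Rightarrow> reading \<Rightarrow> nat \<Rightarrow> nat" where
  "rank_card q R k = (if R = Vector then q ^ k else if k = 0 then 0 else q ^ (k - 1))"

lemma rank_card_inj: "1 < q \<Longrightarrow> rank_card q R k = rank_card q R l \<Longrightarrow> k = l"
  by (cases k; cases l) (auto simp: rank_card_def split: if_splits)

section \<open>Bases, and rank by counting\<close>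

lemma coefficients_finite:
  fixes B :: "'v set"
  assumes "finite B"
  shows "coefficients R B =
    {\<alpha> :: 'v \<Rightarrow> 'a::field. {b. \<alpha> b \<noteq> 0} \<subseteq> B \<and> (R = Affine \<longrightarrow> sum \<alpha> B = 1)}"
proof -
  have "(\<Sum>b | \<alpha> b \<noteq> 0. \<alpha> b) = sum \<alpha> B" if "{b. \<alpha> b \<noteq> 0} \<subseteq> B" for \<alpha> :: "'v \<Rightarrow> 'a"
    by (rule sum.mono_neutral_left) (use that assms in auto)
  then show ?thesis
    using finite_subset[OF _ assms] unfolding coefficients_def by auto
qed

lemma combination_finite:
  assumes "vector_space sc" "finite B" "{b. \<alpha> b \<noteq> 0} \<subseteq> B"
  shows "combination sc \<alpha> = (\<Sum>b\<in>B. sc (\<alpha> b) b)"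
proof -
  interpret vector_space sc by fact
  show ?thesis unfolding combination_def
    by (rule sum.mono_neutral_left) (use assms in auto)
qed

lemma card_coefficients:
  fixes B :: "'v set"
  assumes fin: "finite B"
  shows "finite (coefficients R B :: ('v \<Rightarrow> 'a::{field,finite}) set)"
    and "card (coefficients R B :: ('v \<Rightarrow> 'a) set) = rank_card CARD('a) R (card B)"
proof -
  show "finite (coefficients R B :: ('v \<Rightarrow> 'a) set)"
    by (rule finite_subset[OF _ finite_supported[OF fin]]) (auto simp: coefficients_def)
  show "card (coefficients R B :: ('v \<Rightarrow> 'a) set) = rank_card CARD('a) R (card B)"
  proof (cases "R = Vector \<or> B = {}")
    case True
    then show ?thesis
    proof
      assume "R = Vector"
      then show ?thesis by (simp add: coefficients_finite[OF fin] rank_card_def card_supported[OF fin])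
    next
      assume "B = {}"
      show ?thesis
      proof (cases R)
        case Vector
        then show ?thesis by (simp add: coefficients_finite[OF fin] rank_card_def card_supported[OF fin])
      next
        case Affine
        then show ?thesis using \<open>B = {}\<close> by (simp add: coefficients_finite rank_card_def)
      qed
    qed
  next
    case False
    then have R: "R = Affine" by (cases R) auto
    obtain b0 where b0: "b0 \<in> B" using False by auto
    define B0 where "B0 = B - {b0}"
    have B: "B = insert b0 B0" "b0 \<notin> B0" "finite B0" using b0 fin by (auto simp: B0_def)
    \<comment> \<open>In the affine reading the coefficient of one chosen \<open>b0\<close> is
      determined by the others, which are free.\<close>
    have "bij_betw (\<lambda>f. f(b0 := 1 - sum f B0)) {f::'v \<Rightarrow> 'a. {b. f b \<noteq> 0} \<subseteq> B0} (coefficients R B)"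
    proof (rule bij_betwI[where g = "\<lambda>\<alpha>. \<alpha>(b0 := 0)"])
      have s: "sum (f(b0 := c)) B0 = sum f B0" for f :: "'v \<Rightarrow> 'a" and c
        by (rule sum.cong) (use B in auto)
      show "(\<lambda>f. f(b0 := 1 - sum f B0)) \<in> {f::'v \<Rightarrow> 'a. {b. f b \<noteq> 0} \<subseteq> B0} \<rightarrow> coefficients R B"
        unfolding coefficients_finite[OF fin] using B s by (auto simp: subset_iff)
      show "(\<lambda>\<alpha>. \<alpha>(b0 := 0)) \<in> coefficients R B \<rightarrow> {f::'v \<Rightarrow> 'a. {b. f b \<noteq> 0} \<subseteq> B0}"
        unfolding coefficients_finite[OF fin] using B by (auto split: if_splits)
      show "(f(b0 := 1 - sum f B0))(b0 := 0) = f" if "f \<in> {f::'v \<Rightarrow> 'a. {b. f b \<noteq> 0} \<subseteq> B0}" for f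
        using that B by (auto simp: fun_eq_iff)
      show "(\<alpha>(b0 := 0))(b0 := 1 - sum (\<alpha>(b0 := 0)) B0) = \<alpha>" if "\<alpha> \<in> coefficients R B" for \<alpha> :: "'v \<Rightarrow> 'a"
      proof -
        have "\<alpha> b0 + sum \<alpha> B0 = 1"
          using that R B fin by (simp add: coefficients_finite)
        then have "1 - sum \<alpha> B0 = \<alpha> b0" by (simp add: algebra_simps)
        then show ?thesis by (simp only: s fun_upd_upd) simp
      qed
    qed
    from bij_betw_same_card[OF this] show ?thesis
      using B R by (simp add: card_supported rank_card_def)
  qed
qed

lemma generated_superset:
  assumes "vector_space sc" shows "B \<subseteq> generated R sc B"
proof
  interpret vector_space sc by fact
  fix b assume "b \<in> B"
  then have "(\<Sum>i\<in>{()}. sc 1 b) \<in> generated R sc B"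
    by (intro combination_family) auto
  then show "b \<in> generated R sc B" by simp
qed

lemma generated_mono: "B \<subseteq> B' \<Longrightarrow> generated R sc B \<subseteq> generated R sc B'"
  unfolding generated_def coefficients_def by (intro image_mono) auto

text \<open>A combination of combinations is flattened to one over pairs. In the affine reading the
  inner weights sum to 1, so the total weight is that of the outer combination.\<close>

lemma is_space_generated_set:
  assumes "vector_space (sc :: 'a::field \<Rightarrow> 'v \<Rightarrow> 'v::ab_group_add)"
  shows "is_space R sc (generated R sc B)"
  unfolding is_space_def
proof
  interpret vector_space sc by fact
  fix \<alpha> :: "'v \<Rightarrow> 'a" assume \<alpha>: "\<alpha> \<in> coefficients R (generated R sc B)"
  let ?S = "{b. \<alpha> b \<noteq> 0}"
  have S: "finite ?S" "?S \<subseteq> generated R sc B" and sum1: "R = Affine \<Longrightarrow> sum \<alpha> ?S = 1"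
    using \<alpha> by (auto simp: coefficients_def)
  have "\<forall>b\<in>?S. \<exists>\<beta>. \<beta> \<in> coefficients R B \<and> combination sc \<beta> = b"
    using S(2) unfolding generated_def by blast
  from bchoice[OF this] obtain \<beta> where \<beta>: "\<And>b. b \<in> ?S \<Longrightarrow> \<beta> b \<in> coefficients R B"
    "\<And>b. b \<in> ?S \<Longrightarrow> combination sc (\<beta> b) = b" by blast
  let ?T = "\<lambda>b. {c. \<beta> b c \<noteq> 0}"
  have T: "finite (?T b)" "?T b \<subseteq> B" "R = Affine \<Longrightarrow> sum (\<beta> b) (?T b) = 1" if "b \<in> ?S" for b
    using \<beta>(1)[OF that] by (auto simp: coefficients_def)
  let ?I = "Sigma ?S ?T"
  let ?a = "\<lambda>i. \<alpha> (fst i) * \<beta> (fst i) (snd i)"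
  have "(\<Sum>i\<in>?I. sc (?a i) (snd i)) \<in> generated R sc B"
  proof (rule combination_family)
    show "finite ?I" using S(1) T(1) by (rule finite_SigmaI)
    show "snd i \<in> B" if "i \<in> ?I" for i using that T(2)[of "fst i"] by auto
    assume R: "R = Affine"
    have "sum ?a ?I = (\<Sum>b\<in>?S. \<Sum>c\<in>?T b. \<alpha> b * \<beta> b c)"
      using S(1) T(1) by (subst sum.Sigma) (auto simp: case_prod_beta)
    also have "\<dots> = (\<Sum>b\<in>?S. \<alpha> b)"
      using T(3)[OF _ R] by (intro sum.cong refl) (simp flip: sum_distrib_left)
    finally show "sum ?a ?I = 1" using sum1[OF R] by simp
  qed
  also have "(\<Sum>i\<in>?I. sc (?a i) (snd i)) = (\<Sum>b\<in>?S. \<Sum>c\<in>?T b. sc (\<alpha> b * \<beta> b c) c)"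
    using S(1) T(1) by (subst sum.Sigma) (auto simp: case_prod_beta)
  also have "\<dots> = (\<Sum>b\<in>?S. sc (\<alpha> b) (combination sc (\<beta> b)))"
    unfolding combination_def by (simp add: scale_sum_right)
  also have "\<dots> = combination sc \<alpha>"
    unfolding combination_def[of sc \<alpha>] by (intro sum.cong refl) (simp add: \<beta>(2))
  finally show "combination sc \<alpha> \<in> generated R sc B" .
qed

lemma generated_minimal: "is_space R sc U \<Longrightarrow> B \<subseteq> U \<Longrightarrow> generated R sc B \<subseteq> U"
  unfolding is_space_def generated_def coefficients_def by auto

lemma k_space_card:
  assumes "vector_space (sc :: 'a::{field,finite} \<Rightarrow> 'v \<Rightarrow> 'v::ab_group_add)" "k_space R sc k A"
  shows "finite A" and "card A = rank_card CARD('a) R k"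
proof -
  obtain B where B: "is_basis R sc A B" "finite B" "card B = k"
    using assms(2) by (auto simp: k_space_def)
  have ind: "independent_set R sc B" and gen: "generated R sc B = A" using B(1) by (simp_all add: is_basis_def)
  have inj: "inj_on (combination sc) (coefficients R B)"
  proof (rule inj_onI)
    fix \<alpha> \<beta> assume ab: "\<alpha> \<in> coefficients R B" "\<beta> \<in> coefficients R B" "combination sc \<alpha> = combination sc \<beta>"
    then have "combination sc \<alpha> \<in> generated R sc B" by (simp add: generated_def)
    then have "\<exists>!\<gamma>. \<gamma> \<in> coefficients R B \<and> combination sc \<gamma> = combination sc \<alpha>"
      using ind by (simp add: independent_set_def)
    then show "\<alpha> = \<beta>" using ab by auto
  qed
  show "finite A" using gen card_coefficients(1)[OF B(2), of R] by (auto simp: generated_def)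
  show "card A = rank_card CARD('a) R k"
    using card_image[OF inj] card_coefficients(2)[OF B(2), of R] gen B(3) by (simp add: generated_def)
qed

text \<open>A generating set of least size is independent: two representations of one element that
  differ at \<open>b0\<close> allow \<open>b0\<close> to be expressed by the rest and
  dropped.\<close>

lemma finite_space_has_rank:
  assumes vs: "vector_space (sc :: 'a::field \<Rightarrow> 'v \<Rightarrow> 'v::ab_group_add)" and A: "is_space R sc A" "finite A"
  shows "\<exists>k. k_space R sc k A"
proof -
  interpret vector_space sc by fact
  define P where "P B \<longleftrightarrow> B \<subseteq> A \<and> generated R sc B = A" for B
  have "P A" using generated_minimal[OF A(1), of A] generated_superset[OF vs, of A] by (auto simp: P_def)
  from ex_has_least_nat[of P, OF this, of card] obtain B where "P B" and min: "\<forall>B'. P B' \<longrightarrow> card B \<le> card B'"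
    by (elim exE conjE) (rule that)
  then have B: "B \<subseteq> A" "generated R sc B = A" by (simp_all add: P_def)
  have finB: "finite B" using B A(2) finite_subset by blast
  have "independent_set R sc B"
    unfolding independent_set_def
  proof (intro ballI ex_ex1I)
    fix x assume "x \<in> generated R sc B"
    then show "\<exists>\<alpha>. \<alpha> \<in> coefficients R B \<and> combination sc \<alpha> = x" by (auto simp: generated_def)
  next
    fix x \<alpha> \<beta>
    assume a: "\<alpha> \<in> coefficients R B \<and> combination sc \<alpha> = x"
      and b: "\<beta> \<in> coefficients R B \<and> combination sc \<beta> = x"
    show "\<alpha> = \<beta>"
    proof (rule ccontr)
      assume "\<alpha> \<noteq> \<beta>"
      then obtain b0 where b0: "\<alpha> b0 \<noteq> \<beta> b0" by auto
      have supp: "{b. \<alpha> b \<noteq> 0} \<subseteq> B" "{b. \<beta> b \<noteq> 0} \<subseteq> B"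
        and one: "R = Affine \<Longrightarrow> sum \<alpha> B = 1 \<and> sum \<beta> B = 1"
        using a b by (auto simp: coefficients_finite[OF finB])
      have b0B: "b0 \<in> B"
      proof (rule ccontr)
        assume "b0 \<notin> B"
        then have "\<alpha> b0 = 0" "\<beta> b0 = 0" using supp by blast+
        then show False using b0 by simp
      qed
      define \<gamma> where "\<gamma> b = \<alpha> b - \<beta> b" for b
      have g0: "\<gamma> b0 \<noteq> 0" using b0 by (simp add: \<gamma>_def)
      have "(\<Sum>b\<in>B. sc (\<gamma> b) b) = combination sc \<alpha> - combination sc \<beta>"
        unfolding combination_finite[OF vs finB supp(1)] combination_finite[OF vs finB supp(2)]
        by (simp add: \<gamma>_def scale_left_diff_distrib sum_subtractf)
      then have "sc (\<gamma> b0) b0 + (\<Sum>b\<in>B - {b0}. sc (\<gamma> b) b) = 0"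
        using a b sum.remove[OF finB b0B, of "\<lambda>b. sc (\<gamma> b) b"] by simp
      then have rest: "(\<Sum>b\<in>B - {b0}. sc (\<gamma> b) b) = - sc (\<gamma> b0) b0" by (simp add: eq_neg_iff_add_eq_0 add.commute)
      \<comment> \<open>The relation \<open>\<gamma>\<close> solved for \<open>b0\<close>. In the
        affine reading \<open>\<gamma>\<close> sums to 0 over \<open>B\<close>, which makes these
        coefficients sum to 1.\<close>
      let ?a = "\<lambda>b. - inverse (\<gamma> b0) * \<gamma> b"
      have "(\<Sum>b\<in>B - {b0}. sc (?a b) b) = sc (- inverse (\<gamma> b0)) (\<Sum>b\<in>B - {b0}. sc (\<gamma> b) b)"
        by (simp only: scale_sum_right scale_scale)
      also have "\<dots> = b0" using g0 by (simp add: rest)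
      finally have eq: "(\<Sum>b\<in>B - {b0}. sc (?a b) b) = b0" .
      have "(\<Sum>b\<in>B - {b0}. sc (?a b) b) \<in> generated R sc (B - {b0})"
      proof (rule combination_family)
        assume R: "R = Affine"
        have "sum \<gamma> B = 0" using one[OF R] by (simp add: \<gamma>_def sum_subtractf)
        then have "\<gamma> b0 + sum \<gamma> (B - {b0}) = 0" using sum.remove[OF finB b0B, of \<gamma>] by simp
        then have "sum \<gamma> (B - {b0}) = - \<gamma> b0" by (simp add: eq_neg_iff_add_eq_0 add.commute)
        then show "sum ?a (B - {b0}) = 1" using g0 by (simp only: sum_distrib_left[symmetric]) simp
      qed (use finB in auto)
      then have "b0 \<in> generated R sc (B - {b0})" by (simp only: eq)
      then have "B \<subseteq> generated R sc (B - {b0})" using generated_superset[OF vs, of "B - {b0}" R] by blast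
      then have "generated R sc B \<subseteq> generated R sc (B - {b0})"
        by (rule generated_minimal[OF is_space_generated_set[OF vs]])
      moreover have "generated R sc (B - {b0}) \<subseteq> generated R sc B" by (rule generated_mono) auto
      ultimately have "P (B - {b0})" using B unfolding P_def by blast
      then have "card B \<le> card (B - {b0})" using min by blast
      then show False using card_Diff1_less[OF finB b0B] by simp
    qed
  qed
  then show ?thesis using A B finB unfolding k_space_def is_basis_def by blast
qed

text \<open>Finiteness provides some rank, and counting admits only one. Ranks of images and
  preimages can thus be checked without transporting bases.\<close>

lemma k_space_iff:
  assumes vs: "vector_space (sc :: 'a::{field,finite} \<Rightarrow> 'v \<Rightarrow> 'v::ab_group_add)"
  shows "k_space R sc k A \<longleftrightarrow> is_space R sc A \<and> finite A \<and> card A = rank_card CARD('a) R k"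
proof
  assume A: "k_space R sc k A"
  then have "is_space R sc A" by (simp add: k_space_def)
  then show "is_space R sc A \<and> finite A \<and> card A = rank_card CARD('a) R k"
    using k_space_card[OF vs A] by blast
next
  assume A: "is_space R sc A \<and> finite A \<and> card A = rank_card CARD('a) R k"
  then obtain l where l: "k_space R sc l A" using finite_space_has_rank[OF vs, of R A] by blast
  then have "rank_card CARD('a) R l = rank_card CARD('a) R k" using A k_space_card(2)[OF vs l] by simp
  from rank_card_inj[OF card_field_gt_1 this] show "k_space R sc k A" using l by simp
qed

section \<open>Spaces and families under linear maps\<close>

lemma linear_combination:
  assumes "Vector_Spaces.linear s1 s2 f"
  shows "f (combination s1 \<alpha>) = (\<Sum>b | \<alpha> b \<noteq> 0. s2 (\<alpha> b) (f b))"
proof -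
  interpret Vector_Spaces.linear s1 s2 f by fact
  show ?thesis unfolding combination_def sum scale ..
qed

lemma is_space_image:
  fixes s2 :: "'a::field \<Rightarrow> 'w \<Rightarrow> 'w::ab_group_add"
  assumes f: "Vector_Spaces.linear s1 s2 f" and A: "is_space R s1 A"
  shows "is_space R s2 (f ` A)"
  unfolding is_space_def
proof
  interpret Vector_Spaces.linear s1 s2 f by fact
  fix \<alpha> :: "'w \<Rightarrow> 'a" assume \<alpha>: "\<alpha> \<in> coefficients R (f ` A)"
  let ?S = "{b. \<alpha> b \<noteq> 0}"
  have S: "finite ?S" "?S \<subseteq> f ` A" "R = Affine \<Longrightarrow> sum \<alpha> ?S = 1"
    using \<alpha> by (auto simp: coefficients_def)
  have "\<forall>b\<in>?S. \<exists>a. a \<in> A \<and> f a = b" using S(2) by blast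
  from bchoice[OF this] obtain g where g: "\<And>b. b \<in> ?S \<Longrightarrow> g b \<in> A" "\<And>b. b \<in> ?S \<Longrightarrow> f (g b) = b" by blast
  have "(\<Sum>b\<in>?S. s1 (\<alpha> b) (g b)) \<in> generated R s1 A"
    by (rule vs1.combination_family) (use S g in auto)
  then have inA: "(\<Sum>b\<in>?S. s1 (\<alpha> b) (g b)) \<in> A" using generated_minimal[OF A order_refl] by blast
  have "f (\<Sum>b\<in>?S. s1 (\<alpha> b) (g b)) = combination s2 \<alpha>"
    unfolding combination_def sum scale by (intro sum.cong refl) (simp add: g(2))
  from imageI[OF inA, of f, unfolded this] show "combination s2 \<alpha> \<in> f ` A" .
qed

lemma is_space_inter_vimage:
  fixes s1 :: "'a::field \<Rightarrow> 'v \<Rightarrow> 'v::ab_group_add"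
  assumes f: "Vector_Spaces.linear s1 s2 f" and A: "is_space R s1 A" and B: "is_space R s2 B"
  shows "is_space R s1 {x \<in> A. f x \<in> B}"
  unfolding is_space_def
proof
  interpret Vector_Spaces.linear s1 s2 f by fact
  fix \<alpha> :: "'v \<Rightarrow> 'a" assume \<alpha>: "\<alpha> \<in> coefficients R {x \<in> A. f x \<in> B}"
  let ?S = "{b. \<alpha> b \<noteq> 0}"
  have S: "finite ?S" "?S \<subseteq> {x \<in> A. f x \<in> B}" "R = Affine \<Longrightarrow> sum \<alpha> ?S = 1"
    using \<alpha> by (auto simp: coefficients_def)
  have "combination s1 \<alpha> \<in> A" using A S by (auto simp: is_space_def coefficients_def)
  moreover have "(\<Sum>b\<in>?S. s2 (\<alpha> b) (f b)) \<in> generated R s2 B"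
    by (rule vs2.combination_family) (use S in auto)
  then have "(\<Sum>b\<in>?S. s2 (\<alpha> b) (f b)) \<in> B" using generated_minimal[OF B order_refl] by blast
  then have "f (combination s1 \<alpha>) \<in> B" by (simp only: linear_combination[OF f])
  ultimately show "combination s1 \<alpha> \<in> {x \<in> A. f x \<in> B}" by blast
qed

text \<open>The preimage in \<open>U\<close> of a member of \<open>\<F>\<close> is again a space,
  and counting gives it rank \<open>k\<close>. Linearity of \<open>\<theta>\<close> on the whole
  sequence space supplies the homomorphism property; bijectivity is asked on \<open>U\<close>
  only.\<close>

lemma isomorphic_families_linear:
  fixes sc :: "'a::{field,finite} \<Rightarrow> 'v \<Rightarrow> 'v::ab_group_add" and \<theta> :: "(nat \<Rightarrow> 'a) \<Rightarrow> 'v"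
  assumes vs: "vector_space sc" and \<theta>: "Vector_Spaces.linear fun_scale sc \<theta>"
    and U: "is_space R fun_scale U" "U \<subseteq> X" and C: "is_space R sc C" and bij: "bij_betw \<theta> U C"
    and F: "\<F> \<subseteq> k_subspaces R sc C k"
  shows "isomorphic_families R fun_scale sc X C k {A \<in> k_subspaces R fun_scale U k. \<theta> ` A \<in> \<F>} \<F>"
proof -
  let ?G = "{A \<in> k_subspaces R fun_scale U k. \<theta> ` A \<in> \<F>}"
  have inj: "inj_on \<theta> U" and im: "\<theta> ` U = C" using bij by (auto simp: bij_betw_def)
  have "space_iso R fun_scale sc U C \<theta>"
    unfolding space_iso_def space_hom_def using bij im linear_combination[OF \<theta>] by auto
  moreover have "bij_betw ((`) \<theta>) ?G \<F>"
    unfolding bij_betw_def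
  proof
    show "inj_on ((`) \<theta>) ?G"
      by (rule inj_onI) (auto simp: k_subspaces_def inj_on_image_eq_iff[OF inj])
    show "(`) \<theta> ` ?G = \<F>"
    proof
      show "\<F> \<subseteq> (`) \<theta> ` ?G"
      proof
        fix B assume B: "B \<in> \<F>"
        then have B': "B \<subseteq> C" "k_space R sc k B" using F by (auto simp: k_subspaces_def)
        let ?A = "{x \<in> U. \<theta> x \<in> B}"
        have img: "\<theta> ` ?A = B" using im B'(1) by blast
        have injA: "inj_on \<theta> ?A" using inj by (rule inj_on_subset) auto
        have "is_space R fun_scale ?A"
          using is_space_inter_vimage[OF \<theta> U(1), of B] B'(2) by (simp add: k_space_def)
        moreover have "finite ?A" "card ?A = card B"
          using k_space_card(1)[OF vs B'(2)] finite_imageD[OF _ injA] card_image[OF injA] img by auto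
        ultimately have "k_space R fun_scale k ?A"
          using k_space_card(2)[OF vs B'(2)] by (simp add: k_space_iff[OF vector_space_fun_scale])
        then have "?A \<in> ?G" using img B by (simp add: k_subspaces_def)
        then show "B \<in> (`) \<theta> ` ?G" using img by (metis (no_types) imageI)
      qed
    qed auto
  qed
  ultimately show ?thesis
    unfolding isomorphic_families_def using U C F by (intro exI[of _ U] exI[of _ C] exI[of _ \<theta>]) auto
qed

section \<open>Level sets: from linear subspaces to spaces of either reading\<close>

definition slice :: "reading \<Rightarrow> ((nat \<Rightarrow> 'a::field) \<Rightarrow> nat \<Rightarrow> 'a) \<Rightarrow> (nat \<Rightarrow> 'a) set \<Rightarrow> (nat \<Rightarrow> 'a) set" where
  "slice R \<pi> W = {x \<in> W. R = Affine \<longrightarrow> \<pi> x 0 = 1}"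

lemma slice_subset: "slice R \<pi> W \<subseteq> W"
  by (auto simp: slice_def)

lemma sum_fun_apply: "(\<Sum>b\<in>B. f b) x = (\<Sum>b\<in>B. f b x)"
  by (induction B rule: infinite_finite_induct) auto

text \<open>On points of level 1 the functional returns the sum of the coefficients; so a linear
  combination of such points stays at level 1 exactly when it is affine.\<close>

lemma linear_combination_coord:
  assumes "lin \<pi>" "{b. \<alpha> b \<noteq> 0} \<subseteq> {x. \<pi> x 0 = 1}"
  shows "\<pi> (combination fun_scale \<alpha>) 0 = (\<Sum>b | \<alpha> b \<noteq> 0. \<alpha> b)"
  unfolding linear_combination[OF assms(1)] sum_fun_apply
  by (intro sum.cong refl) (use assms(2) in auto)

lemma is_space_slice:
  assumes "lin \<pi>" "subsp W"
  shows "is_space R fun_scale (slice R \<pi> W)"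
  unfolding is_space_def
proof
  fix \<alpha> :: "(nat \<Rightarrow> 'a) \<Rightarrow> 'a" assume \<alpha>: "\<alpha> \<in> coefficients R (slice R \<pi> W)"
  have "combination fun_scale \<alpha> \<in> W"
    unfolding combination_def using \<alpha>
    by (intro fs.vs1.subspace_sum[OF assms(2)] fs.vs1.subspace_scale[OF assms(2)])
       (auto simp: coefficients_def slice_def)
  moreover have "\<pi> (combination fun_scale \<alpha>) 0 = 1" if "R = Affine"
    using linear_combination_coord[OF assms(1), of \<alpha>] \<alpha> that by (auto simp: coefficients_def slice_def)
  ultimately show "combination fun_scale \<alpha> \<in> slice R \<pi> W" by (simp add: slice_def)
qed

lemma slice_point:
  assumes "lin \<pi>" "subsp W" "\<exists>x\<in>W. \<pi> x 0 \<noteq> 0"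
  obtains w where "w \<in> W" "\<pi> w 0 = 1"
proof -
  obtain x where x: "x \<in> W" "\<pi> x 0 \<noteq> 0" using assms(3) by blast
  show thesis
  proof
    show "fun_scale (inverse (\<pi> x 0)) x \<in> W" by (rule fs.vs1.subspace_scale[OF assms(2) x(1)])
    show "\<pi> (fun_scale (inverse (\<pi> x 0)) x) 0 = 1" using x(2) by (simp add: lin_scale[OF assms(1)])
  qed
qed

lemma card_slice:
  fixes W :: "(nat \<Rightarrow> 'a::{field,finite}) set"
  assumes \<pi>: "lin \<pi>" and W: "subsp W" and good: "R = Affine \<longrightarrow> (\<exists>x\<in>W. \<pi> x 0 \<noteq> 0)"
  shows "card W = card (slice R \<pi> W) * (if R = Affine then CARD('a) else 1)"
proof (cases R)
  case Vector
  then show ?thesis by (simp add: slice_def)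
next
  case Affine
  then obtain w where w: "w \<in> W" "\<pi> w 0 = 1" using slice_point[OF \<pi> W] good by blast
  have \<pi>_shift: "\<pi> (x + fun_scale c w) 0 = \<pi> x 0 + c" for x c
    using w(2) by (simp add: lin_add[OF \<pi>] lin_scale[OF \<pi>])
  have W_shift: "x + fun_scale c w \<in> W" if "x \<in> W" for x c
    by (intro fs.vs1.subspace_add[OF W that] fs.vs1.subspace_scale[OF W w(1)])
  \<comment> \<open>Each point is moved to level 1 in the direction of \<open>w\<close>, and the
    level it came from is recorded.\<close>
  have "bij_betw (\<lambda>x. (x + fun_scale (1 - \<pi> x 0) w, \<pi> x 0)) W (slice R \<pi> W \<times> UNIV)"
  proof (rule bij_betwI[where g = "\<lambda>(s, a). s + fun_scale (a - 1) w"])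
    show "(\<lambda>x. (x + fun_scale (1 - \<pi> x 0) w, \<pi> x 0)) \<in> W \<rightarrow> slice R \<pi> W \<times> UNIV"
      using W_shift by (auto simp: slice_def \<pi>_shift)
    show "(\<lambda>(s, a). s + fun_scale (a - 1) w) \<in> slice R \<pi> W \<times> UNIV \<rightarrow> W"
      using W_shift by (auto simp: slice_def)
    show "(case (x + fun_scale (1 - \<pi> x 0) w, \<pi> x 0) of (s, a) \<Rightarrow> s + fun_scale (a - 1) w) = x" for x
      by (simp add: fun_eq_iff algebra_simps)
    fix y assume y: "y \<in> slice R \<pi> W \<times> (UNIV :: 'a set)"
    obtain s a where sa: "y = (s, a)" by (cases y)
    then have "\<pi> s 0 = 1" using y Affine by (simp add: slice_def)
    then show "((case y of (s, a) \<Rightarrow> s + fun_scale (a - 1) w) +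
        fun_scale (1 - \<pi> (case y of (s, a) \<Rightarrow> s + fun_scale (a - 1) w) 0) w,
        \<pi> (case y of (s, a) \<Rightarrow> s + fun_scale (a - 1) w) 0) = y"
      by (simp add: sa \<pi>_shift) (simp add: fun_eq_iff algebra_simps)
  qed
  from bij_betw_same_card[OF this] show ?thesis using Affine by (simp add: card_cartesian_product)
qed

lemma span_slice:
  assumes \<pi>: "lin \<pi>" and W: "subsp W" and good: "R = Affine \<longrightarrow> (\<exists>x\<in>W. \<pi> x 0 \<noteq> 0)"
  shows "fs.vs1.span (slice R \<pi> W) = W"
proof
  show "fs.vs1.span (slice R \<pi> W) \<subseteq> W" by (rule fs.vs1.span_minimal[OF slice_subset W])
  show "W \<subseteq> fs.vs1.span (slice R \<pi> W)"
  proof (cases R)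
    case Vector
    then show ?thesis using fs.vs1.span_superset[of W] by (simp add: slice_def)
  next
    case Affine
    then obtain w where w: "w \<in> W" "\<pi> w 0 = 1" using slice_point[OF \<pi> W] good by blast
    have ws: "w \<in> fs.vs1.span (slice R \<pi> W)" using w by (intro fs.vs1.span_base) (simp add: slice_def)
    show ?thesis
    proof
      fix x assume x: "x \<in> W"
      have "x + fun_scale (1 - \<pi> x 0) w \<in> W"
        by (intro fs.vs1.subspace_add[OF W x] fs.vs1.subspace_scale[OF W w(1)])
      moreover have "\<pi> (x + fun_scale (1 - \<pi> x 0) w) 0 = 1"
        using w(2) by (simp add: lin_add[OF \<pi>] lin_scale[OF \<pi>])
      ultimately have "x + fun_scale (1 - \<pi> x 0) w \<in> fs.vs1.span (slice R \<pi> W)"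
        by (intro fs.vs1.span_base) (simp add: slice_def)
      then have "x + fun_scale (1 - \<pi> x 0) w - fun_scale (1 - \<pi> x 0) w \<in> fs.vs1.span (slice R \<pi> W)"
        by (intro fs.vs1.span_diff fs.vs1.span_scale ws)
      then show "x \<in> fs.vs1.span (slice R \<pi> W)" by simp
    qed
  qed
qed

lemma slice_span:
  assumes \<pi>: "lin \<pi>" and A: "is_space R fun_scale A" and h: "R = Affine \<longrightarrow> A \<subseteq> {x. \<pi> x 0 = 1}"
  shows "slice R \<pi> (fs.vs1.span A) = A"
proof
  show "A \<subseteq> slice R \<pi> (fs.vs1.span A)" using h fs.vs1.span_base by (auto simp: slice_def)
  show "slice R \<pi> (fs.vs1.span A) \<subseteq> A"
  proof
    fix x assume x: "x \<in> slice R \<pi> (fs.vs1.span A)"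
    then have "x \<in> generated Vector fun_scale A" by (simp add: slice_def fs.vs1.generated_Vector)
    then obtain \<alpha> where \<alpha>: "\<alpha> \<in> coefficients Vector A" "x = combination fun_scale \<alpha>" by (auto simp: generated_def)
    have "(\<Sum>b | \<alpha> b \<noteq> 0. \<alpha> b) = 1" if R: "R = Affine"
    proof -
      have "{b. \<alpha> b \<noteq> 0} \<subseteq> {x. \<pi> x 0 = 1}" using \<alpha>(1) h R by (auto simp: coefficients_def)
      from linear_combination_coord[OF \<pi> this] show ?thesis using x R \<alpha>(2) by (simp add: slice_def)
    qed
    then have "\<alpha> \<in> coefficients R A" using \<alpha>(1) by (simp add: coefficients_def)
    then show "x \<in> A" using A \<alpha>(2) by (simp add: is_space_def)
  qed
qed

subsection \<open>The induced theorem\<close>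

text \<open>Affine rank \<open>k\<close> becomes linear dimension \<open>k\<close>: as affine rank
  already counts one more than the dimension, homogenising shifts neither \<open>k\<close> nor
  \<open>n\<close>.\<close>

lemma rank_card_mult: "0 < k \<Longrightarrow> rank_card q R k * (if R = Affine then q else 1) = q ^ k"
  by (cases R; cases k) (auto simp: rank_card_def)

lemma k_space_standard: "k_space R fun_scale n (slice R (\<lambda>x. x) (vec n :: (nat \<Rightarrow> 'a::{field,finite}) set))"
  unfolding k_space_iff[OF vector_space_fun_scale]
proof (intro conjI)
  let ?V = "vec n :: (nat \<Rightarrow> 'a) set"
  show "is_space R fun_scale (slice R (\<lambda>x. x) ?V)" by (rule is_space_slice[OF lin_id(2) subsp_vec])
  show "finite (slice R (\<lambda>x. x) ?V)" by (rule finite_subset[OF slice_subset finite_vec])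
  show "card (slice R (\<lambda>x. x) ?V) = rank_card CARD('a) R n"
  proof (cases "R = Affine \<and> n = 0")
    case True
    then have "slice R (\<lambda>x. x) ?V = {}" by (auto simp: slice_def vec_def)
    then show ?thesis using True by (simp add: rank_card_def)
  next
    case False
    have "R = Affine \<longrightarrow> (\<exists>x\<in>?V. x 0 \<noteq> 0)"
      using False by (intro impI bexI[of _ "unit 0"]) (auto simp: unit_def vec_def)
    from card_slice[OF lin_id(2) subsp_vec this] show ?thesis
      using False by (cases R; cases n) (auto simp: rank_card_def card_vec)
  qed
qed

text \<open>In positive rank, span is inverse to slicing. An affine 0-subspace is empty and spans
  only the zero space, which misses the level set.\<close>

lemma span_in_grass:
  fixes T :: "(nat \<Rightarrow> 'a::{field,finite}) set"
  assumes T: "T \<in> k_subspaces R fun_scale (slice R (\<lambda>x. x) (vec n)) k" and k: "0 < k"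
  shows "fs.vs1.span T \<in> grass (R = Affine) k n" and "slice R (\<lambda>x. x) (fs.vs1.span T) = T"
proof -
  have T': "is_space R fun_scale T" "card T = rank_card CARD('a) R k" "T \<subseteq> slice R (\<lambda>x. x) (vec n)"
    using T by (auto simp: k_subspaces_def k_space_iff[OF vector_space_fun_scale])
  have h: "R = Affine \<longrightarrow> T \<subseteq> {x. x 0 = 1}" using T'(3) by (auto simp: slice_def)
  show sl: "slice R (\<lambda>x. x) (fs.vs1.span T) = T" by (rule slice_span[OF lin_id(2) T'(1) h])
  have "card T \<noteq> 0" using k by (simp add: T'(2) rank_card_def)
  then obtain x where x: "x \<in> T" by fastforce
  have good: "R = Affine \<longrightarrow> (\<exists>x\<in>fs.vs1.span T. x 0 \<noteq> 0)"
    using h fs.vs1.span_base[OF x] x by (auto intro!: bexI[of _ x])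
  then have "card (fs.vs1.span T) = CARD('a) ^ k"
    using card_slice[OF lin_id(2) fs.vs1.subspace_span, of R T] T'(2) rank_card_mult[OF k, of "CARD('a)" R]
    by (simp add: sl)
  moreover have "fs.vs1.span T \<subseteq> vec n"
    by (rule fs.vs1.span_minimal[OF _ subsp_vec]) (use T'(3) slice_subset in blast)
  ultimately show "fs.vs1.span T \<in> grass (R = Affine) k n"
    using good by (simp add: grass_def)
qed

section \<open>Coordinates on a given space\<close>

lemma vector_coordinates:
  fixes sc :: "'a::{field,finite} \<Rightarrow> 'v \<Rightarrow> 'v::ab_group_add"
  assumes vs: "vector_space sc" and C: "k_space Vector sc n C"
  shows "\<exists>\<phi>. Vector_Spaces.linear fun_scale sc \<phi> \<and> bij_betw \<phi> (vec n) C"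
proof -
  interpret vector_space sc by fact
  obtain B where B: "independent B" "span B = C" "finite B" "card B = n"
    using C by (auto simp: k_space_Vector)
  obtain b where b: "bij_betw b {..<n} B"
    using ex_bij_betw_nat_finite[OF B(3)] B(4) by (auto simp: atLeast0LessThan)
  define \<phi> where "\<phi> x = (\<Sum>i<n. sc (x i) (b i))" for x
  have "Vector_Spaces.linear fun_scale sc \<phi>"
    unfolding Vector_Spaces.linear_iff
    using vs vector_space_fun_scale
    by (simp add: \<phi>_def scale_left_distrib sum.distrib scale_sum_right)
  moreover have img: "\<phi> ` vec n = C"
  proof
    have "b i \<in> span B" if "i < n" for i using b that by (intro span_base) (auto simp: bij_betw_def)
    then show "\<phi> ` vec n \<subseteq> C"
      unfolding \<phi>_def B(2)[symmetric] by (auto intro!: span_sum span_scale)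
    show "C \<subseteq> \<phi> ` vec n"
    proof
      fix v assume "v \<in> C"
      then obtain u where "v = (\<Sum>a\<in>B. sc (u a) a)" using B(2) span_finite[OF B(3)] by auto
      also have "\<dots> = (\<Sum>i<n. sc (u (b i)) (b i))"
        by (rule sum.reindex_bij_betw[OF b, symmetric])
      also have "\<dots> = \<phi> (\<lambda>i. if i < n then u (b i) else 0)"
        unfolding \<phi>_def by (intro sum.cong) auto
      finally show "v \<in> \<phi> ` vec n" by (intro image_eqI[of v \<phi>]) (auto simp: vec_def)
    qed
  qed
  moreover have "inj_on \<phi> (vec n)"
    by (rule eq_card_imp_inj_on[OF finite_vec])
       (use k_space_card(2)[OF vs C] img in \<open>simp add: card_vec rank_card_def\<close>)
  ultimately show ?thesis unfolding bij_betw_def by blast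
qed

lemma space_coordinates:
  fixes sc :: "'a::{field,finite} \<Rightarrow> 'v \<Rightarrow> 'v::ab_group_add"
  assumes vs: "vector_space sc" and C: "k_space R sc n C"
  shows "\<exists>\<phi>. Vector_Spaces.linear fun_scale sc \<phi> \<and> bij_betw \<phi> (slice R (\<lambda>x. x) (vec n)) C"
proof -
  interpret vector_space sc by fact
  interpret vp: vector_space_pair fun_scale sc by (intro vector_space_pair.intro vector_space_fun_scale vs)
  have cardC: "finite C" "card C = rank_card CARD('a) R n" by (rule k_space_card[OF vs C])+
  consider "R = Vector" | "R = Affine" "n = 0" | m where "R = Affine" "n = Suc m"
    by (cases R; cases n) auto
  then show ?thesis
  proof cases
    case 1
    then have "slice R (\<lambda>x. x) (vec n) = (vec n :: (nat \<Rightarrow> 'a) set)" by (simp add: slice_def)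
    then show ?thesis using vector_coordinates[OF vs] C 1 by simp
  next
    case 2
    then have "C = {}" "slice R (\<lambda>x. x) (vec n) = ({} :: (nat \<Rightarrow> 'a) set)"
      using cardC by (auto simp: rank_card_def slice_def vec_def)
    then show ?thesis using vp.linear_zero by (intro exI[of _ "\<lambda>x. 0"]) (simp add: bij_betw_def)
  next
    case (3 m)
    have "card C \<noteq> 0" by (simp add: cardC(2) rank_card_def 3)
    then have "C \<noteq> {}" by auto
    then obtain p L where L: "subspace L" "C = (\<lambda>x. p + x) ` L"
      using C is_space_Affine 3(1) by (auto simp: k_space_def)
    have inj: "inj_on (\<lambda>x. p + x) L" by simp
    have "finite L" using cardC(1) L(2) finite_imageD[OF _ inj] by simp
    moreover have "card L = CARD('a) ^ m"
      using cardC(2) card_image[OF inj] L(2) by (simp add: rank_card_def 3)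
    ultimately have "k_space Vector sc m L"
      using L(1) by (simp add: k_space_iff[OF vs] is_space_Vector rank_card_def)
    then obtain \<psi> where \<psi>: "Vector_Spaces.linear fun_scale sc \<psi>" "bij_betw \<psi> (vec m) L"
      using vector_coordinates[OF vs] by blast
    define shift :: "(nat \<Rightarrow> 'a) \<Rightarrow> nat \<Rightarrow> 'a" where "shift x = (\<lambda>i. x (Suc i))" for x
    \<comment> \<open>Coordinate 0 is the weight of the base point \<open>p\<close>, the others
      parametrise the direction space \<open>L\<close>. Injectivity holds on the level set but may
      fail on \<open>vec n\<close>: if \<open>C\<close> contains 0, its own span is too small to
      homogenise in, whence the passage to the sequence space.\<close>
    define \<phi> where "\<phi> x = sc (x 0) p + \<psi> (shift x)" for x
    have "shift (x + y) = shift x + shift y" "shift (fun_scale c x) = fun_scale c (shift x)" for x y c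
      by (simp_all add: shift_def fun_eq_iff)
    then have "Vector_Spaces.linear fun_scale sc \<phi>"
      unfolding Vector_Spaces.linear_iff
      using vs vector_space_fun_scale
      by (simp add: \<phi>_def scale_left_distrib scale_right_distrib vp.linear_add[OF \<psi>(1)]
          vp.linear_scale[OF \<psi>(1)] add.assoc add.left_commute)
    moreover have "bij_betw shift (slice R (\<lambda>x. x) (vec n)) (vec m)"
    proof (rule bij_betwI[where g = "\<lambda>x i. case i of 0 \<Rightarrow> 1 | Suc j \<Rightarrow> x j"])
      show "shift \<in> slice R (\<lambda>x. x) (vec n) \<rightarrow> vec m" by (auto simp: shift_def slice_def vec_def 3)
      show "(\<lambda>x i. case i of 0 \<Rightarrow> 1 | Suc j \<Rightarrow> x j) \<in> vec m \<rightarrow> slice R (\<lambda>x. x) (vec n)"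
        by (auto simp: slice_def vec_def 3 split: nat.split)
      show "(\<lambda>i. case i of 0 \<Rightarrow> 1 | Suc j \<Rightarrow> shift x j) = x" if "x \<in> slice R (\<lambda>x. x) (vec n)" for x
        using that 3 by (auto simp: fun_eq_iff shift_def slice_def split: nat.split)
      show "shift (\<lambda>i. case i of 0 \<Rightarrow> 1 | Suc j \<Rightarrow> x j) = x" for x
        by (simp add: shift_def)
    qed
    then have "bij_betw ((\<lambda>x. p + x) \<circ> (\<psi> \<circ> shift)) (slice R (\<lambda>x. x) (vec n)) C"
      using \<psi>(2) inj L(2) by (intro bij_betw_trans) (auto simp: bij_betw_def)
    then have "bij_betw \<phi> (slice R (\<lambda>x. x) (vec n)) C"
      by (rule bij_betw_cong[THEN iffD1, rotated]) (simp add: \<phi>_def slice_def 3)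
    ultimately show ?thesis by blast
  qed
qed

text \<open>The zero space, or the empty one in the affine reading, is the only candidate
  \<open>A0\<close> for a member, so every colouring is constant and the standard
  \<open>n\<close>-space serves as both ambient space and copy.\<close>

lemma induced_ramsey_rank_0:
  fixes sc :: "'a::{field,finite} \<Rightarrow> 'v \<Rightarrow> 'v::ab_group_add"
  assumes vs: "vector_space sc" and C: "k_space R sc n C" and F: "\<F> \<subseteq> k_subspaces R sc C 0"
  shows "\<exists>(X :: (nat \<Rightarrow> 'a) set) \<H>. k_space R fun_scale n X \<and> \<H> \<subseteq> k_subspaces R fun_scale X 0 \<and>
    (\<forall>\<chi>. monochromatic \<chi> (k_subspaces R fun_scale X 0 \<inter> \<H>) \<and>
       isomorphic_families R fun_scale sc X C 0 (k_subspaces R fun_scale X 0 \<inter> \<H>) \<F>)"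
proof -
  let ?X = "slice R (\<lambda>x. x) (vec n) :: (nat \<Rightarrow> 'a) set"
  obtain \<phi> where \<phi>: "Vector_Spaces.linear fun_scale sc \<phi>" "bij_betw \<phi> ?X C"
    using space_coordinates[OF vs C] by blast
  let ?H = "{A \<in> k_subspaces R fun_scale ?X 0. \<phi> ` A \<in> \<F>}"
  have X: "k_space R fun_scale n ?X" by (rule k_space_standard)
  have eq: "k_subspaces R fun_scale ?X 0 \<inter> ?H = ?H" by blast
  have "is_space R fun_scale ?X" "is_space R sc C" using X C by (simp_all add: k_space_def)
  then have iso: "isomorphic_families R fun_scale sc ?X C 0 ?H \<F>"
    by (intro isomorphic_families_linear[OF vs \<phi>(1) _ order_refl _ \<phi>(2) F])
  define A0 where "A0 = (if R = Vector then {0} else {} :: (nat \<Rightarrow> 'a) set)"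
  have A0: "A = A0" if "A \<in> k_subspaces R fun_scale ?X 0" for A
  proof (cases R)
    case Vector
    then have "subsp A" "card A = 1"
      using that by (auto simp: k_subspaces_def k_space_iff[OF vector_space_fun_scale] fs.vs1.is_space_Vector rank_card_def)
    then show ?thesis using fs.vs1.subspace_0[of A] Vector by (auto simp: card_1_singleton_iff A0_def)
  next
    case Affine
    then have "finite A" "card A = 0"
      using that by (auto simp: k_subspaces_def k_space_iff[OF vector_space_fun_scale] rank_card_def)
    then show ?thesis using Affine by (simp add: A0_def)
  qed
  have mono: "monochromatic \<chi> ?H" for \<chi>
    unfolding monochromatic_def
  proof (intro exI[of _ "\<chi> A0"] ballI)
    fix S assume "S \<in> ?H"
    then have "S = A0" using A0 by blast
    then show "\<chi> S = \<chi> A0" by (rule arg_cong)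
  qed
  show ?thesis
  proof (rule exI[of _ ?X], rule exI[of _ ?H], intro conjI allI)
    show "?H \<subseteq> k_subspaces R fun_scale ?X 0" by blast
  qed (simp_all only: X eq mono iso)
qed

lemma finite_span:
  fixes S :: "(nat \<Rightarrow> 'a::{field,finite}) set"
  assumes "finite S"
  shows "finite (fs.vs1.span S)"
proof -
  have "finite (generated Vector fun_scale S)"
    unfolding generated_def using card_coefficients(1)[OF assms] by (rule finite_imageI)
  then show ?thesis by (simp only: fs.vs1.generated_Vector)
qed

lemma slice_image:
  assumes W: "W \<subseteq> vec n" and coord: "R = Affine \<longrightarrow> (\<forall>x\<in>vec n. \<pi> (\<psi> x) 0 = x 0)"
  shows "slice R \<pi> (\<psi> ` W) = \<psi> ` slice R (\<lambda>x. x) W"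
proof -
  have "(R = Affine \<longrightarrow> \<pi> (\<psi> x) 0 = 1) \<longleftrightarrow> (R = Affine \<longrightarrow> x 0 = 1)" if "x \<in> W" for x
    using subsetD[OF W that] coord by auto
  then show ?thesis unfolding slice_def by blast
qed

text \<open>
  Passing to slices loses nothing: a slice of positive rank determines its linear subspace, as its
  span.
\<close>

lemma induced_copy_slice:
  fixes sc :: "'a::{field,finite} \<Rightarrow> 'v \<Rightarrow> 'v::ab_group_add"
  assumes vs: "vector_space sc" and C: "k_space R sc n C" and F: "\<F> \<subseteq> k_subspaces R sc C k" and k: "0 < k"
    and \<phi>: "Vector_Spaces.linear fun_scale sc \<phi>" "bij_betw \<phi> (slice R (\<lambda>x. x) (vec n)) C"
    and \<pi>: "lin \<pi>" and H: "\<forall>W\<in>H. subsp W"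
    and copy: "induced_copy (R = Affine) n {W \<in> grass (R = Affine) k n. \<phi> ` slice R (\<lambda>x. x) W \<in> \<F>} \<pi> H \<kappa> \<psi>"
    and X: "slice R \<pi> (\<psi> ` vec n) \<subseteq> X"
    and \<H>: "\<H> = k_subspaces R fun_scale X k \<inter> slice R \<pi> ` H"
    and \<kappa>: "\<And>W. W \<in> H \<Longrightarrow> slice R \<pi> W \<in> \<H> \<Longrightarrow> \<kappa> W = \<chi> (slice R \<pi> W)"
  shows "\<exists>U\<in>k_subspaces R fun_scale X n. monochromatic \<chi> (k_subspaces R fun_scale U k \<inter> \<H>) \<and>
           isomorphic_families R fun_scale sc X C k (k_subspaces R fun_scale U k \<inter> \<H>) \<F>"
proof -
  let ?F = "{W \<in> grass (R = Affine) k n. \<phi> ` slice R (\<lambda>x. x) W \<in> \<F>}"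
  let ?V = "slice R (\<lambda>x. x) (vec n) :: (nat \<Rightarrow> 'a) set"
  have \<psi>: "lin \<psi>" "inj_on \<psi> (vec n)" and coord: "R = Affine \<longrightarrow> (\<forall>x\<in>vec n. \<pi> (\<psi> x) 0 = x 0)"
    and ind: "\<forall>W. \<psi> ` W \<in> H \<longleftrightarrow> W \<in> ?F" and mono: "\<exists>a. \<forall>W\<in>?F. \<kappa> (\<psi> ` W) = a"
    using copy unfolding induced_copy_def by simp_all
  obtain g where g: "lin g" "\<forall>x\<in>vec n. g (\<psi> x) = x"
    using fs.linear_exists_left_inverse_on[OF \<psi>(1) subsp_vec \<psi>(2)] by blast
  define U where "U = \<psi> ` ?V"
  have V: "?V \<subseteq> vec n" by (rule slice_subset)
  have g\<psi>: "g (\<psi> x) = x" if "x \<in> ?V" for x using g(2) V that by blast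
  have U_slice: "slice R \<pi> (\<psi> ` vec n) = U" unfolding U_def by (rule slice_image[where \<psi> = \<psi> and \<pi> = \<pi>, OF order_refl coord])
  have UX: "U \<subseteq> X" using X U_slice by simp
  have injV: "inj_on \<psi> ?V" using \<psi>(2) V by (rule inj_on_subset)
  have kV: "k_space R fun_scale n ?V" by (rule k_space_standard)
  then have U_space: "is_space R fun_scale U"
    unfolding U_def using is_space_image[OF \<psi>(1)] by (simp add: k_space_def)
  moreover have "finite U" "card U = rank_card CARD('a) R n"
    using k_space_card[OF vector_space_fun_scale kV] card_image[OF injV] by (simp_all add: U_def)
  ultimately have "k_space R fun_scale n U" by (simp add: k_space_iff[OF vector_space_fun_scale])
  then have U_sub: "U \<in> k_subspaces R fun_scale X n" using UX by (simp add: k_subspaces_def)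
  have bij_g: "bij_betw g U ?V"
    by (rule bij_betwI[where g = \<psi>]) (auto simp: U_def g\<psi>)
  define \<theta> where "\<theta> = \<phi> \<circ> g"
  have \<theta>: "Vector_Spaces.linear fun_scale sc \<theta>"
    unfolding \<theta>_def by (rule Vector_Spaces.linear_compose[OF g(1) \<phi>(1)])
  have bij_\<theta>: "bij_betw \<theta> U C" unfolding \<theta>_def by (rule bij_betw_trans[OF bij_g \<phi>(2)])
  \<comment> \<open>A subspace \<open>S\<close> of \<open>U\<close> is pulled back by
    \<open>g\<close> and replaced by its span \<open>W\<close> in \<open>vec n\<close>; this
    translates questions about \<open>S\<close> into those that \<open>induced_copy\<close> answers
    for \<open>W\<close>.\<close>
  have member: "\<exists>W\<in>grass (R = Affine) k n. S = slice R \<pi> (\<psi> ` W) \<and> fs.vs1.span S = \<psi> ` W \<and> \<theta> ` S = \<phi> ` slice R (\<lambda>x. x) W"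
    if S: "S \<in> k_subspaces R fun_scale U k" for S
  proof -
    have S': "S \<subseteq> U" "is_space R fun_scale S" "finite S" "card S = rank_card CARD('a) R k"
      using S by (simp_all add: k_subspaces_def k_space_iff[OF vector_space_fun_scale])
    let ?T = "g ` S"
    have injS: "inj_on g S" using bij_g S'(1) unfolding bij_betw_def by (meson inj_on_subset)
    have TV: "?T \<subseteq> ?V" using bij_g S'(1) unfolding bij_betw_def by blast
    have \<psi>T: "\<psi> ` ?T = S"
    proof -
      have "\<psi> (g x) = x" if "x \<in> S" for x using that S'(1) g\<psi> by (auto simp: U_def)
      then show ?thesis by (simp add: image_image)
    qed
    have "?T \<in> k_subspaces R fun_scale ?V k"
      using TV is_space_image[OF g(1) S'(2)] S'(3,4) card_image[OF injS]
      by (simp add: k_subspaces_def k_space_iff[OF vector_space_fun_scale])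
    from span_in_grass[OF this k] have W: "fs.vs1.span ?T \<in> grass (R = Affine) k n" "slice R (\<lambda>x. x) (fs.vs1.span ?T) = ?T" .
    have "fs.vs1.span ?T \<subseteq> vec n" using W(1) by (simp add: grass_def)
    from slice_image[where \<psi> = \<psi> and \<pi> = \<pi>, OF this coord] have "slice R \<pi> (\<psi> ` fs.vs1.span ?T) = S" by (simp add: W(2) \<psi>T)
    moreover have "fs.vs1.span S = \<psi> ` fs.vs1.span ?T"
      using fs.linear_span_image[OF \<psi>(1), of ?T] \<psi>T by simp
    moreover have "\<theta> ` S = \<phi> ` slice R (\<lambda>x. x) (fs.vs1.span ?T)" by (simp add: W(2) \<theta>_def image_comp)
    ultimately show ?thesis using W(1) by blast
  qed
  have key: "S \<in> \<H> \<longleftrightarrow> \<theta> ` S \<in> \<F>" if S: "S \<in> k_subspaces R fun_scale U k" for S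
  proof -
    obtain W where W: "W \<in> grass (R = Affine) k n" "S = slice R \<pi> (\<psi> ` W)" "fs.vs1.span S = \<psi> ` W"
      "\<theta> ` S = \<phi> ` slice R (\<lambda>x. x) W" using member[OF S] by blast
    have SX: "S \<in> k_subspaces R fun_scale X k" using S UX by (auto simp: k_subspaces_def)
    show ?thesis
    proof
      assume "\<theta> ` S \<in> \<F>"
      then have "\<psi> ` W \<in> H" using ind W by simp
      then show "S \<in> \<H>" using SX W(2) by (simp add: \<H>)
    next
      assume "S \<in> \<H>"
      \<comment> \<open>A priori \<open>S\<close> is the slice of some other member
        \<open>W1\<close>. Having positive rank, it spans \<open>W1\<close>, and it also spans the
        image of \<open>W\<close>; so the two agree.\<close>
      then obtain W1 where W1: "W1 \<in> H" "S = slice R \<pi> W1" by (auto simp: \<H>)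
      have "card S \<noteq> 0" using S k by (simp add: k_subspaces_def k_space_iff[OF vector_space_fun_scale] rank_card_def)
      then obtain x where x: "x \<in> S" by fastforce
      have "R = Affine \<longrightarrow> (\<exists>x\<in>W1. \<pi> x 0 \<noteq> 0)"
        using x W1(2) by (intro impI bexI[of _ x]) (auto simp: slice_def)
      then have "fs.vs1.span S = W1" using span_slice[OF \<pi>, of W1 R] H W1 by simp
      then have "\<psi> ` W \<in> H" using W1(1) W(3) by simp
      then show "\<theta> ` S \<in> \<F>" using ind W(4) by simp
    qed
  qed
  have eq: "k_subspaces R fun_scale U k \<inter> \<H> = {S \<in> k_subspaces R fun_scale U k. \<theta> ` S \<in> \<F>}"
    using key by blast
  have "isomorphic_families R fun_scale sc X C k (k_subspaces R fun_scale U k \<inter> \<H>) \<F>"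
    unfolding eq using C by (intro isomorphic_families_linear[OF vs \<theta> U_space UX _ bij_\<theta> F]) (simp add: k_space_def)
  moreover have "monochromatic \<chi> (k_subspaces R fun_scale U k \<inter> \<H>)"
  proof -
    obtain a where a: "\<forall>W\<in>?F. \<kappa> (\<psi> ` W) = a" using mono by blast
    have "\<chi> S = a" if S: "S \<in> k_subspaces R fun_scale U k \<inter> \<H>" for S
    proof -
      obtain W where W: "W \<in> grass (R = Affine) k n" "S = slice R \<pi> (\<psi> ` W)" "\<theta> ` S = \<phi> ` slice R (\<lambda>x. x) W"
        using member S by blast
      then have WF: "W \<in> ?F" using key S by auto
      then have "\<psi> ` W \<in> H" using ind by blast
      then have "\<kappa> (\<psi> ` W) = \<chi> S" using \<kappa> W(2) S by simp
      then show ?thesis using a WF by simp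
    qed
    then show ?thesis unfolding monochromatic_def by blast
  qed
  ultimately show ?thesis using U_sub by blast
qed

theorem theorem1p2:
  fixes R :: reading
    and k n r :: nat
    and sc :: "'a::{field,finite} \<Rightarrow> 'v \<Rightarrow> 'v::ab_group_add"
    and C :: "'v set"
    and \<F> :: "'v set set"
  assumes "k \<le> n" and "0 < r"
    and "vector_space sc"
    and "k_space R sc n C"
    and "\<F> \<subseteq> k_subspaces R sc C k"
  shows "\<exists>(N::nat) (X :: (nat \<Rightarrow> 'a) set) \<H>.
           k_space R fun_scale N X \<and> \<H> \<subseteq> k_subspaces R fun_scale X k \<and>
           (\<forall>\<chi>. \<chi> ` \<H> \<subseteq> {..<r} \<longrightarrow>
             (\<exists>U\<in>k_subspaces R fun_scale X n.
                monochromatic \<chi> (k_subspaces R fun_scale U k \<inter> \<H>) \<and>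
                isomorphic_families R fun_scale sc X C k (k_subspaces R fun_scale U k \<inter> \<H>) \<F>))"
proof (cases "k = 0")
  case True
  then have F: "\<F> \<subseteq> k_subspaces R sc C 0" using assms(5) by simp
  from induced_ramsey_rank_0[OF assms(3,4) F]
  obtain X :: "(nat \<Rightarrow> 'a) set" and \<H> where X: "k_space R fun_scale n X" "\<H> \<subseteq> k_subspaces R fun_scale X 0"
    and *: "\<forall>\<chi>. monochromatic \<chi> (k_subspaces R fun_scale X 0 \<inter> \<H>) \<and>
       isomorphic_families R fun_scale sc X C 0 (k_subspaces R fun_scale X 0 \<inter> \<H>) \<F>"
    by (elim exE conjE) (rule that)
  have "X \<in> k_subspaces R fun_scale X n" using X(1) by (simp add: k_subspaces_def)
  then show ?thesis
    unfolding True using X * by (rule_tac exI[of _ n], rule_tac exI[of _ X], rule_tac exI[of _ \<H>]) blast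
next
  case False
  then have k: "0 < k" by simp
  obtain \<phi> where \<phi>: "Vector_Spaces.linear fun_scale sc \<phi>" "bij_betw \<phi> (slice R (\<lambda>x. x) (vec n)) C"
    using space_coordinates[OF assms(3,4)] by blast
  let ?F = "{W \<in> grass (R = Affine) k n. \<phi> ` slice R (\<lambda>x. x) W \<in> \<F>}"
  have "?F \<subseteq> grass (R = Affine) k n" by blast
  from induced_ramsey_linear[OF assms(2) k this]
  obtain \<pi> :: "(nat \<Rightarrow> 'a) \<Rightarrow> nat \<Rightarrow> 'a" and H where \<pi>: "lin \<pi>" and finH: "finite H" and H: "\<forall>W\<in>H. subsp W"
    and ram: "\<forall>\<chi> :: (nat \<Rightarrow> 'a) set \<Rightarrow> nat. (\<forall>W. \<chi> W < r) \<longrightarrow> (\<exists>\<psi>. induced_copy (R = Affine) n ?F \<pi> H \<chi> \<psi>)"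
    by (elim exE conjE) (rule that)
  \<comment> \<open>The copies could lie anywhere in the infinite sequence space. Only the values on
    the finite \<open>H\<close> matter, so these finitely many colourings represent all of
    them.\<close>
  define K where "K = {\<kappa> :: (nat \<Rightarrow> 'a) set \<Rightarrow> nat. {W. \<kappa> W \<noteq> 0} \<subseteq> H \<and> (\<forall>W. \<kappa> W < r)}"
  have finK: "finite K"
  proof -
    have "K \<subseteq> {\<kappa>. \<forall>W. (W \<in> H \<longrightarrow> \<kappa> W \<in> {..<r}) \<and> (W \<notin> H \<longrightarrow> \<kappa> W = 0)}"
      by (auto simp: K_def)
    moreover have "finite \<dots>" by (rule finite_set_of_finite_funs[OF finH]) simp
    ultimately show ?thesis by (rule finite_subset)
  qed
  have "\<forall>\<kappa>\<in>K. \<exists>\<psi>. induced_copy (R = Affine) n ?F \<pi> H \<kappa> \<psi>"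
  proof
    fix \<kappa> assume "\<kappa> \<in> K"
    then have "\<forall>W. \<kappa> W < r" by (simp add: K_def)
    then show "\<exists>\<psi>. induced_copy (R = Affine) n ?F \<pi> H \<kappa> \<psi>" by (rule ram[THEN spec, THEN mp])
  qed
  from bchoice[OF this] obtain \<Psi> where \<Psi>: "\<forall>\<kappa>\<in>K. induced_copy (R = Affine) n ?F \<pi> H \<kappa> (\<Psi> \<kappa>)" ..
  \<comment> \<open>One copy per colouring spans a finite subspace; \<open>N\<close> is whatever
    rank its slice turns out to have.\<close>
  define Y where "Y = fs.vs1.span (\<Union>\<kappa>\<in>K. \<Psi> \<kappa> ` vec n)"
  define X where "X = slice R \<pi> Y"
  have "finite Y" unfolding Y_def using finK by (intro finite_span finite_UN_I finite_imageI finite_vec)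
  then have "finite X" unfolding X_def by (rule finite_subset[OF slice_subset])
  moreover have "is_space R fun_scale X"
    unfolding X_def Y_def by (rule is_space_slice[OF \<pi> fs.vs1.subspace_span])
  ultimately obtain N where N: "k_space R fun_scale N X"
    using finite_space_has_rank[OF vector_space_fun_scale, of R X] by blast
  \<comment> \<open>The intersection discards the members of \<open>H\<close> whose slice does not
    lie in \<open>X\<close>.\<close>
  define \<H> where "\<H> = k_subspaces R fun_scale X k \<inter> slice R \<pi> ` H"
  have main: "\<exists>U\<in>k_subspaces R fun_scale X n. monochromatic \<chi> (k_subspaces R fun_scale U k \<inter> \<H>) \<and>
      isomorphic_families R fun_scale sc X C k (k_subspaces R fun_scale U k \<inter> \<H>) \<F>"
    if \<chi>: "\<chi> ` \<H> \<subseteq> {..<r}" for \<chi>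
  proof -
    \<comment> \<open>Colours pass from slices back to linear members; the rest get the default 0, a
      legal colour since \<open>r\<close> is positive.\<close>
    define \<kappa> where "\<kappa> W = (if W \<in> H \<and> slice R \<pi> W \<in> \<H> then \<chi> (slice R \<pi> W) else 0)" for W
    have "\<kappa> W < r" for W using \<chi> assms(2) by (auto simp: \<kappa>_def)
    moreover have "{W. \<kappa> W \<noteq> 0} \<subseteq> H" by (auto simp: \<kappa>_def)
    ultimately have \<kappa>: "\<kappa> \<in> K" by (simp add: K_def)
    have "\<Psi> \<kappa> ` vec n \<subseteq> (\<Union>\<kappa>\<in>K. \<Psi> \<kappa> ` vec n)" using \<kappa> by (rule UN_upper)
    also have "\<dots> \<subseteq> Y" unfolding Y_def by (rule fs.vs1.span_superset)
    finally have sub: "slice R \<pi> (\<Psi> \<kappa> ` vec n) \<subseteq> X" by (auto simp: X_def slice_def)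
    show ?thesis
    proof (rule induced_copy_slice[OF assms(3,4,5) k \<phi> \<pi> H bspec[OF \<Psi> \<kappa>] sub \<H>_def])
      show "\<kappa> W = \<chi> (slice R \<pi> W)" if "W \<in> H" "slice R \<pi> W \<in> \<H>" for W
        using that by (simp add: \<kappa>_def)
    qed
  qed
  show ?thesis
  proof (rule exI[of _ N], rule exI[of _ X], rule exI[of _ \<H>], intro conjI allI impI)
    show "\<H> \<subseteq> k_subspaces R fun_scale X k" by (simp add: \<H>_def)
  qed (rule N, rule main)
qed

end
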